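(* Let $k$ be a field, $(C,Q)$ a Rota-Baxter coalgebra of weight $-1$ over $k$, and $(M,Q,T)$ a Rota-Baxter paired $C$-comodule of weight $-1$. Define $\widetilde{\rho}:M\to C\otimes M$ by $$\widetilde{\rho}(m)=Q(m_{(-1)})\otimes m_{(0)}+m_{(-1)}\otimes T(m_{(0)})-m_{(-1)}\otimes m_{(0)}.$$ Then $(M,\widetilde{\rho})$ is a left $\widetilde{C}$-pre-Lie comodule, where $\widetilde{C}=(C,\widetilde{\Delta})$ is the pre-Lie coalgebra with $\widetilde{\Delta}(c)=Q(c_1)\otimes c_2-Q(c_2)\otimes c_1-c_1\otimes c_2$.
   Context: All spaces, maps and tensor products are over $k$. Sweedler notation: $\Delta(c)=c_1\otimes c_2$; left coaction $\rho(m)=m_{(-1)}\otimes m_{(0)}\in C\otimes M$. A coalgebra $(C,\Delta)$ with a linear map $Q:C\to C$ is a Rota-Baxter coalgebra of weight $\lambda$ if $(Q\otimes Q)\Delta=(Q\otimes \mathrm{id})\Delta Q+(\mathrm{id}\otimes Q)\Delta Q+\lambda\Delta Q$. For a left $C$-comodule $M$ and linear maps $Q:C\to C$, $T:M\to M$, $(M,Q,T)$ is a Rota-Baxter paired (left) $C$-comodule of weight $\lambda$ if $(Q\otimes T)\rho=(Q\otimes \mathrm{id})\rho T+(\mathrm{id}\otimes T)\rho T+\lambda\rho T$. A pre-Lie coalgebra is a space $C$ with a linear map $\Delta:C\to C\otimes C$ such that $\Delta_C-\Phi_{(12)}\Delta_C=0$, where $\Delta_C=(\Delta\otimes\mathrm{id})\Delta-(\mathrm{id}\otimes\Delta)\Delta$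 and $\Phi_{(12)}(a\otimes b\otimes c)=b\otimes a\otimes c$. A left pre-Lie comodule over a pre-Lie coalgebra $(C,\Delta)$ is a space $M$ with a linear map $\rho:M\to C\otimes M$ such that $\rho_M-(\tau\otimes\mathrm{id})\rho_M=0$, where $\rho_M=(\mathrm{id}\otimes\rho)\rho-(\Delta\otimes\mathrm{id})\rho$ and $\tau(c\otimes d)=d\otimes c$. It is known that, for $(C,Q)$ a Rota-Baxter coalgebra of weight $-1$, the $\widetilde{C}$ in the statement is a pre-Lie coalgebra. *)

theory Defs
  imports "Jordan_Normal_Form.Missing_VectorSpace" "HOL-Algebra.AbelCoset"
begin

section \<open>Tensor products of vector spaces\<close>

text \<open>Finitely supported functions \<open>S \<rightarrow> K\<close>, i.e. the vector space with basis \<open>S\<close>.\<close>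

definition free_space :: "('k, 'r) ring_scheme \<Rightarrow> 's set \<Rightarrow> ('k, 's \<Rightarrow> 'k) module" where
  "free_space K S = (ring.func_space K S)
     \<lparr>carrier := {f \<in> carrier (ring.func_space K S). finite {s \<in> S. f s \<noteq> \<zero>\<^bsub>K\<^esub>}}\<rparr>"

definition free_gen :: "('k, 'r) ring_scheme \<Rightarrow> 's set \<Rightarrow> 's \<Rightarrow> 's \<Rightarrow> 'k" where
  "free_gen K S s = (\<lambda>t\<in>S. if t = s then \<one>\<^bsub>K\<^esub> else \<zero>\<^bsub>K\<^esub>)"

text \<open>A module record also carries a ring multiplication and unit, which no module axiom
  mentions; they are left \<open>undefined\<close>.\<close>

definition quotient_module :: "('k, 'm, 'z) module_scheme \<Rightarrow> 'm set \<Rightarrow> ('k, 'm set) module" where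
  "quotient_module M N =
     \<lparr>carrier = a_rcosets\<^bsub>M\<^esub> N, mult = undefined, one = undefined,
      zero = N, add = (\<lambda>X Y. X <+>\<^bsub>M\<^esub> Y),
      smult = (\<lambda>r X. \<Union>x\<in>X. N +>\<^bsub>M\<^esub> (r \<odot>\<^bsub>M\<^esub> x))\<rparr>"

definition bilinear_relators ::
  "('k, 'r) ring_scheme \<Rightarrow> ('k, 'a, 'x) module_scheme \<Rightarrow> ('k, 'b, 'y) module_scheme
    \<Rightarrow> ('a \<times> 'b \<Rightarrow> 'k) set" where
  "bilinear_relators K A B =
    (let S = carrier A \<times> carrier B; F = free_space K S; \<delta> = free_gen K S in
      {\<delta> (a \<oplus>\<^bsub>A\<^esub> a', b) \<ominus>\<^bsub>F\<^esub> \<delta> (a, b) \<ominus>\<^bsub>F\<^esub> \<delta> (a', b) | a a' b.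
         a \<in> carrier A \<and> a' \<in> carrier A \<and> b \<in> carrier B} \<union>
      {\<delta> (a, b \<oplus>\<^bsub>B\<^esub> b') \<ominus>\<^bsub>F\<^esub> \<delta> (a, b) \<ominus>\<^bsub>F\<^esub> \<delta> (a, b') | a b b'.
         a \<in> carrier A \<and> b \<in> carrier B \<and> b' \<in> carrier B} \<union>
      {\<delta> (r \<odot>\<^bsub>A\<^esub> a, b) \<ominus>\<^bsub>F\<^esub> r \<odot>\<^bsub>F\<^esub> \<delta> (a, b) | r a b.
         r \<in> carrier K \<and> a \<in> carrier A \<and> b \<in> carrier B} \<union>
      {\<delta> (a, r \<odot>\<^bsub>B\<^esub> b) \<ominus>\<^bsub>F\<^esub> r \<odot>\<^bsub>F\<^esub> \<delta> (a, b) | r a b.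
         r \<in> carrier K \<and> a \<in> carrier A \<and> b \<in> carrier B})"

definition relator_space ::
  "('k, 'r) ring_scheme \<Rightarrow> ('k, 'a, 'x) module_scheme \<Rightarrow> ('k, 'b, 'y) module_scheme
    \<Rightarrow> ('a \<times> 'b \<Rightarrow> 'k) set" where
  "relator_space K A B =
     module.span K (free_space K (carrier A \<times> carrier B)) (bilinear_relators K A B)"

definition tensor ::
  "('k, 'r) ring_scheme \<Rightarrow> ('k, 'a, 'x) module_scheme \<Rightarrow> ('k, 'b, 'y) module_scheme
    \<Rightarrow> ('k, ('a \<times> 'b \<Rightarrow> 'k) set) module" where
  "tensor K A B =
     quotient_module (free_space K (carrier A \<times> carrier B)) (relator_space K A B)"

definition pure_tensor ::
  "('k, 'r) ring_scheme \<Rightarrow> ('k, 'a, 'x) module_scheme \<Rightarrow> ('k, 'b, 'y) module_scheme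
    \<Rightarrow> 'a \<Rightarrow> 'b \<Rightarrow> ('a \<times> 'b \<Rightarrow> 'k) set" where
  "pure_tensor K A B a b =
     relator_space K A B +>\<^bsub>free_space K (carrier A \<times> carrier B)\<^esub>
       free_gen K (carrier A \<times> carrier B) (a, b)"

text \<open>The linear map \<open>A \<otimes> B \<rightarrow> W\<close> induced by a bilinear map \<open>\<beta>\<close>, that is \<open>a \<otimes> b \<mapsto> \<beta> a b\<close>.
  The value at a coset \<open>X\<close> is the common value of the linear extension of \<open>\<beta>\<close> at the
  representatives \<open>x \<in> X\<close>; this is meaningful only if \<open>\<beta>\<close> is bilinear.  Sweedler notation is
  rendered with this map: \<open>\<beta>(c\<^sub>1, c\<^sub>2)\<close> is the induced map applied to \<open>\<Delta> c\<close>.\<close>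

definition tensor_lift ::
  "('k, 'r) ring_scheme \<Rightarrow> ('k, 'a, 'x) module_scheme \<Rightarrow> ('k, 'b, 'y) module_scheme
    \<Rightarrow> ('k, 'w, 'z) module_scheme \<Rightarrow> ('a \<Rightarrow> 'b \<Rightarrow> 'w) \<Rightarrow> ('a \<times> 'b \<Rightarrow> 'k) set \<Rightarrow> 'w" where
  "tensor_lift K A B W \<beta> X =
     (THE w. \<forall>x\<in>X. w = (\<Oplus>\<^bsub>W\<^esub>p\<in>{p \<in> carrier A \<times> carrier B. x p \<noteq> \<zero>\<^bsub>K\<^esub>}.
                          x p \<odot>\<^bsub>W\<^esub> \<beta> (fst p) (snd p)))"

definition tensor_map ::
  "('k, 'r) ring_scheme \<Rightarrow> ('k, 'a, 'x) module_scheme \<Rightarrow> ('k, 'b, 'y) module_scheme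
    \<Rightarrow> ('k, 'c, 'u) module_scheme \<Rightarrow> ('k, 'd, 'v) module_scheme
    \<Rightarrow> ('a \<Rightarrow> 'c) \<Rightarrow> ('b \<Rightarrow> 'd) \<Rightarrow> ('a \<times> 'b \<Rightarrow> 'k) set \<Rightarrow> ('c \<times> 'd \<Rightarrow> 'k) set" where
  "tensor_map K A B A' B' f g =
     tensor_lift K A B (tensor K A' B') (\<lambda>a b. pure_tensor K A' B' (f a) (g b))"

definition tensor_swap ::
  "('k, 'r) ring_scheme \<Rightarrow> ('k, 'a, 'x) module_scheme \<Rightarrow> ('k, 'b, 'y) module_scheme
    \<Rightarrow> ('a \<times> 'b \<Rightarrow> 'k) set \<Rightarrow> ('b \<times> 'a \<Rightarrow> 'k) set" where
  "tensor_swap K A B = tensor_lift K A B (tensor K B A) (\<lambda>a b. pure_tensor K B A b a)"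

text \<open>The canonical identification \<open>A \<otimes> (B \<otimes> D) \<rightarrow> (A \<otimes> B) \<otimes> D\<close>.  All identities between maps
  into threefold tensor products are stated below in the bracketing \<open>(A \<otimes> B) \<otimes> D\<close>, in which
  \<open>\<Phi>\<^bsub>(12)\<^esub>\<close> is \<open>\<tau> \<otimes> id\<close>.\<close>

definition tensor_assoc ::
  "('k, 'r) ring_scheme \<Rightarrow> ('k, 'a, 'x) module_scheme \<Rightarrow> ('k, 'b, 'y) module_scheme
    \<Rightarrow> ('k, 'd, 'z) module_scheme
    \<Rightarrow> ('a \<times> ('b \<times> 'd \<Rightarrow> 'k) set \<Rightarrow> 'k) set \<Rightarrow> (('a \<times> 'b \<Rightarrow> 'k) set \<times> 'd \<Rightarrow> 'k) set" where
  "tensor_assoc K A B D =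
     (let W = tensor K (tensor K A B) D in
      tensor_lift K A (tensor K B D) W
        (\<lambda>a. tensor_lift K B D W
          (\<lambda>b d. pure_tensor K (tensor K A B) D (pure_tensor K A B a b) d)))"


section \<open>Coalgebras, comodules and their Rota-Baxter versions\<close>

text \<open>Coalgebras and comodules are coassociative; no counit is required.\<close>

locale coalgebra = vectorspace K C
  for K :: "('k, 'r) ring_scheme" and C :: "('k, 'c, 'x) module_scheme"
    and \<Delta> :: "'c \<Rightarrow> ('c \<times> 'c \<Rightarrow> 'k) set" +
  assumes comult_linear: "\<Delta> \<in> module_hom K C (tensor K C C)"
    and coassociative: "c \<in> carrier C \<Longrightarrow>
      tensor_map K C C (tensor K C C) C \<Delta> id (\<Delta> c) =
      tensor_assoc K C C C (tensor_map K C C C (tensor K C C) id \<Delta> (\<Delta> c))"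

locale Rota_Baxter_coalgebra = coalgebra K C \<Delta>
  for K :: "('k, 'r) ring_scheme" and C :: "('k, 'c, 'x) module_scheme" and \<Delta>
    and wt :: 'k and Q :: "'c \<Rightarrow> 'c" +
  assumes weight_closed: "wt \<in> carrier K"
    and operator_linear: "Q \<in> module_hom K C C"
    and Rota_Baxter: "c \<in> carrier C \<Longrightarrow>
      tensor_map K C C C C Q Q (\<Delta> c) =
      tensor_map K C C C C Q id (\<Delta> (Q c)) \<oplus>\<^bsub>tensor K C C\<^esub>
      tensor_map K C C C C id Q (\<Delta> (Q c)) \<oplus>\<^bsub>tensor K C C\<^esub>
      wt \<odot>\<^bsub>tensor K C C\<^esub> \<Delta> (Q c)"

locale left_comodule = coalgebra K C \<Delta> + M: vectorspace K M
  for K :: "('k, 'r) ring_scheme" and C :: "('k, 'c, 'x) module_scheme" and \<Delta>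
    and M :: "('k, 'm, 'y) module_scheme" and \<rho> :: "'m \<Rightarrow> ('c \<times> 'm \<Rightarrow> 'k) set" +
  assumes coaction_linear: "\<rho> \<in> module_hom K M (tensor K C M)"
    and coaction_coassociative: "m \<in> carrier M \<Longrightarrow>
      tensor_map K C M (tensor K C C) M \<Delta> id (\<rho> m) =
      tensor_assoc K C C M (tensor_map K C M C (tensor K C M) id \<rho> (\<rho> m))"

locale Rota_Baxter_paired_comodule = left_comodule K C \<Delta> M \<rho>
  for K :: "('k, 'r) ring_scheme" and C :: "('k, 'c, 'x) module_scheme" and \<Delta>
    and M :: "('k, 'm, 'y) module_scheme" and \<rho>
    and wt :: 'k and Q :: "'c \<Rightarrow> 'c" and T :: "'m \<Rightarrow> 'm" +
  assumes weight_closed: "wt \<in> carrier K"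
    and Q_linear: "Q \<in> module_hom K C C"
    and T_linear: "T \<in> module_hom K M M"
    and paired: "m \<in> carrier M \<Longrightarrow>
      tensor_map K C M C M Q T (\<rho> m) =
      tensor_map K C M C M Q id (\<rho> (T m)) \<oplus>\<^bsub>tensor K C M\<^esub>
      tensor_map K C M C M id T (\<rho> (T m)) \<oplus>\<^bsub>tensor K C M\<^esub>
      wt \<odot>\<^bsub>tensor K C M\<^esub> \<rho> (T m)"


section \<open>Pre-Lie coalgebras and comodules\<close>

definition coassociator ::
  "('k, 'r) ring_scheme \<Rightarrow> ('k, 'c, 'x) module_scheme \<Rightarrow> ('c \<Rightarrow> ('c \<times> 'c \<Rightarrow> 'k) set)
    \<Rightarrow> 'c \<Rightarrow> (('c \<times> 'c \<Rightarrow> 'k) set \<times> 'c \<Rightarrow> 'k) set" where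
  "coassociator K C \<Delta> c =
     tensor_map K C C (tensor K C C) C \<Delta> id (\<Delta> c)
     \<ominus>\<^bsub>tensor K (tensor K C C) C\<^esub>
     tensor_assoc K C C C (tensor_map K C C C (tensor K C C) id \<Delta> (\<Delta> c))"

locale pre_Lie_coalgebra = vectorspace K C
  for K :: "('k, 'r) ring_scheme" and C :: "('k, 'c, 'x) module_scheme"
    and \<Delta> :: "'c \<Rightarrow> ('c \<times> 'c \<Rightarrow> 'k) set" +
  assumes comult_linear: "\<Delta> \<in> module_hom K C (tensor K C C)"
    and pre_Lie: "c \<in> carrier C \<Longrightarrow>
      coassociator K C \<Delta> c
      \<ominus>\<^bsub>tensor K (tensor K C C) C\<^esub>
      tensor_map K (tensor K C C) C (tensor K C C) C (tensor_swap K C C) id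
        (coassociator K C \<Delta> c)
      = \<zero>\<^bsub>tensor K (tensor K C C) C\<^esub>"

definition comodule_coassociator ::
  "('k, 'r) ring_scheme \<Rightarrow> ('k, 'c, 'x) module_scheme \<Rightarrow> ('c \<Rightarrow> ('c \<times> 'c \<Rightarrow> 'k) set)
    \<Rightarrow> ('k, 'm, 'y) module_scheme \<Rightarrow> ('m \<Rightarrow> ('c \<times> 'm \<Rightarrow> 'k) set)
    \<Rightarrow> 'm \<Rightarrow> (('c \<times> 'c \<Rightarrow> 'k) set \<times> 'm \<Rightarrow> 'k) set" where
  "comodule_coassociator K C \<Delta> M \<rho> m =
     tensor_assoc K C C M (tensor_map K C M C (tensor K C M) id \<rho> (\<rho> m))
     \<ominus>\<^bsub>tensor K (tensor K C C) M\<^esub>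
     tensor_map K C M (tensor K C C) M \<Delta> id (\<rho> m)"

locale left_pre_Lie_comodule = pre_Lie_coalgebra K C \<Delta> + M: vectorspace K M
  for K :: "('k, 'r) ring_scheme" and C :: "('k, 'c, 'x) module_scheme" and \<Delta>
    and M :: "('k, 'm, 'y) module_scheme" and \<rho> :: "'m \<Rightarrow> ('c \<times> 'm \<Rightarrow> 'k) set" +
  assumes coaction_linear: "\<rho> \<in> module_hom K M (tensor K C M)"
    and pre_Lie_comodule: "m \<in> carrier M \<Longrightarrow>
      comodule_coassociator K C \<Delta> M \<rho> m
      \<ominus>\<^bsub>tensor K (tensor K C C) M\<^esub>
      tensor_map K (tensor K C C) M (tensor K C C) M (tensor_swap K C C) id
        (comodule_coassociator K C \<Delta> M \<rho> m)
      = \<zero>\<^bsub>tensor K (tensor K C C) M\<^esub>"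


section \<open>The derived comultiplication and coaction\<close>

definition pre_Lie_comult ::
  "('k, 'r) ring_scheme \<Rightarrow> ('k, 'c, 'x) module_scheme \<Rightarrow> ('c \<Rightarrow> ('c \<times> 'c \<Rightarrow> 'k) set)
    \<Rightarrow> ('c \<Rightarrow> 'c) \<Rightarrow> 'c \<Rightarrow> ('c \<times> 'c \<Rightarrow> 'k) set" where
  "pre_Lie_comult K C \<Delta> Q c =
     tensor_lift K C C (tensor K C C)
       (\<lambda>c1 c2. pure_tensor K C C (Q c1) c2
          \<ominus>\<^bsub>tensor K C C\<^esub> pure_tensor K C C (Q c2) c1
          \<ominus>\<^bsub>tensor K C C\<^esub> pure_tensor K C C c1 c2)
       (\<Delta> c)"

definition pre_Lie_coaction ::
  "('k, 'r) ring_scheme \<Rightarrow> ('k, 'c, 'x) module_scheme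
    \<Rightarrow> ('k, 'm, 'y) module_scheme \<Rightarrow> ('m \<Rightarrow> ('c \<times> 'm \<Rightarrow> 'k) set)
    \<Rightarrow> ('c \<Rightarrow> 'c) \<Rightarrow> ('m \<Rightarrow> 'm) \<Rightarrow> 'm \<Rightarrow> ('c \<times> 'm \<Rightarrow> 'k) set" where
  "pre_Lie_coaction K C M \<rho> Q T m =
     tensor_lift K C M (tensor K C M)
       (\<lambda>c n. pure_tensor K C M (Q c) n
          \<oplus>\<^bsub>tensor K C M\<^esub> pure_tensor K C M c (T n)
          \<ominus>\<^bsub>tensor K C M\<^esub> pure_tensor K C M c n)
       (\<rho> m)"

end

theory Submission
  imports Defs
begin

text \<open>A linear map out of a tensor product is a bilinear map, so identities between iterated
  coproducts can be tested on trilinear maps \<open>H\<close> into an arbitrary module; the pre-Lie condition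
  needs only those \<open>H\<close> which are alternating in the two coalgebra arguments.  Pulling \<open>H\<close> back
  along \<open>(id \<otimes> \<rho>') \<rho>'\<close>, with \<open>\<rho>'\<close> the derived coaction, and using the Rota-Baxter condition once
  gives \<open>\<rho>\<close> applied twice to a seven-term form \<open>E\<close>.  On an alternating \<open>H\<close> the derived
  comultiplication \<open>\<Delta>'\<close> acts like \<open>c \<mapsto> Q c\<^sub>1 \<otimes> c\<^sub>2 + c\<^sub>1 \<otimes> Q c\<^sub>2 - c\<^sub>1 \<otimes> c\<^sub>2\<close>, which is the derived coaction
  of \<open>C\<close> on itself, so the same Rota-Baxter step shows that \<open>(\<Delta>' \<otimes> id) \<rho>'\<close> also leads to \<open>E\<close>, and
  coassociativity of \<open>\<rho>\<close> identifies the two.\<close>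

text \<open>A tensor here is a coset of finitely supported functions, so a Sweedler sum has no
  preferred representative. Operations on tensors are therefore transposed to operations on forms:
  evaluating \<beta> at \<rho>' m amounts to evaluating \<open>derived_form W Q T \<beta>\<close> at
  \<rho> m. In this language the Rota-Baxter condition with \<lambda> = -1 says that the derived
  form of \<beta>, evaluated at \<rho> (T m), is the single term \<open>\<beta> (Q c) (T n)\<close>
  evaluated at \<rho> m; the coefficient -1 in \<rho>' is the weight. This explains the count seven:
  two nested derived forms give nine terms, and three of them collapse to one. The collapse takes
  place at T of the module factor on one side and at Q of the coalgebra factor on the other, yet the
  same seven terms remain. From H only the sign change under exchange of its first two arguments is
  used, never a division by 2, so the characteristic of k is arbitrary. That C with \<Delta>' is a
  pre-Lie coalgebra is part of the conclusion and is proved by the same calculus, with one extra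
  cancellation caused by the swapped term of \<Delta>'.\<close>

section \<open>Linear maps between modules\<close>

lemma module_homI:
  assumes "\<And>x. x \<in> carrier A \<Longrightarrow> f x \<in> carrier B"
    and "\<And>x y. x \<in> carrier A \<Longrightarrow> y \<in> carrier A \<Longrightarrow> f (x \<oplus>\<^bsub>A\<^esub> y) = f x \<oplus>\<^bsub>B\<^esub> f y"
    and "\<And>r x. r \<in> carrier K \<Longrightarrow> x \<in> carrier A \<Longrightarrow> f (r \<odot>\<^bsub>A\<^esub> x) = r \<odot>\<^bsub>B\<^esub> f x"
  shows "f \<in> module_hom K A B"
  using assms by (auto simp: module_hom_def)

lemma module_hom_in: "f \<in> module_hom K A B \<Longrightarrow> x \<in> carrier A \<Longrightarrow> f x \<in> carrier B"
  by (auto simp: module_hom_def)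

text \<open>Agreement on the carrier is all that is available for total functions; the module
  structure on \<open>A\<close> keeps sums and multiples inside the carrier, where the two functions
  agree.\<close>

lemma module_hom_cong:
  assumes "module K A" and "\<And>x. x \<in> carrier A \<Longrightarrow> f x = g x" and "f \<in> module_hom K A B"
  shows "g \<in> module_hom K A B"
proof -
  interpret module K A by fact
  show ?thesis
    using assms(2,3) by (auto simp: module_hom_def Pi_iff)
qed

lemma module_hom_id: "id \<in> module_hom K A A"
  by (auto simp: module_hom_def)

lemma module_hom_compose:
  "f \<in> module_hom K A B \<Longrightarrow> g \<in> module_hom K B W \<Longrightarrow> (\<lambda>x. g (f x)) \<in> module_hom K A W"
  by (auto simp: module_hom_def Pi_iff)

lemma module_hom_minus:
  assumes "module K A" "module K B" "f \<in> module_hom K A B" "x \<in> carrier A" "y \<in> carrier A"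
  shows "f (x \<ominus>\<^bsub>A\<^esub> y) = f x \<ominus>\<^bsub>B\<^esub> f y"
proof -
  interpret mod_hom K A B f using assms by (simp add: mod_hom_def mod_hom_axioms_def)
  show ?thesis using assms by simp
qed

lemma module_hom_uminus:
  assumes "module K A" "module K B" "f \<in> module_hom K A B" "x \<in> carrier A"
  shows "f (\<ominus>\<^bsub>A\<^esub> x) = \<ominus>\<^bsub>B\<^esub> f x"
proof -
  interpret mod_hom K A B f using assms by (simp add: mod_hom_def mod_hom_axioms_def)
  show ?thesis using assms by simp
qed

lemma module_hom_zero:
  assumes "module K A" "module K B" "f \<in> module_hom K A B"
  shows "f \<zero>\<^bsub>A\<^esub> = \<zero>\<^bsub>B\<^esub>"
proof -
  interpret mod_hom K A B f using assms by (simp add: mod_hom_def mod_hom_axioms_def)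
  show ?thesis by simp
qed

lemma module_hom_plus_fun:
  assumes "module K W" "f \<in> module_hom K A W" "g \<in> module_hom K A W"
  shows "(\<lambda>x. f x \<oplus>\<^bsub>W\<^esub> g x) \<in> module_hom K A W"
proof -
  interpret W: module K W by fact
  show ?thesis
    using assms(2,3) by (auto simp: module_hom_def Pi_iff W.smult_r_distr W.M.a_ac)
qed

lemma module_hom_uminus_fun:
  assumes "module K W" "f \<in> module_hom K A W"
  shows "(\<lambda>x. \<ominus>\<^bsub>W\<^esub> f x) \<in> module_hom K A W"
proof -
  interpret W: module K W by fact
  show ?thesis
    using assms(2) by (auto simp: module_hom_def Pi_iff W.smult_r_minus W.M.minus_add)
qed

lemma module_hom_minus_fun:
  assumes "module K W" "f \<in> module_hom K A W" "g \<in> module_hom K A W"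
  shows "(\<lambda>x. f x \<ominus>\<^bsub>W\<^esub> g x) \<in> module_hom K A W"
  unfolding a_minus_def by (intro module_hom_plus_fun module_hom_uminus_fun assms)

text \<open>Rests on commutativity of K: multiplication by \<open>r\<close> has to commute with the
  scalar tested in the linearity condition.\<close>

lemma module_hom_smult_fun:
  assumes "module K W" "f \<in> module_hom K A W" "r \<in> carrier K"
  shows "(\<lambda>x. r \<odot>\<^bsub>W\<^esub> f x) \<in> module_hom K A W"
proof -
  interpret W: module K W by fact
  show ?thesis
    using assms(2,3)
    by (auto simp: module_hom_def Pi_iff W.smult_r_distr W.smult_assoc1[symmetric] W.R.m_comm)
qed


section \<open>Quotient modules\<close>

text \<open>The operations on cosets are given by set-level formulas that choose no representative.
  Each is shown to agree with the operation on representatives, after which the module laws are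
  inherited from \<open>M\<close> along the projection.\<close>

lemma quotient_module:
  assumes M: "module K M" and N: "submodule K N M"
  shows quotient_module_module: "module K (quotient_module M N)"
    and quotient_proj_hom: "(\<lambda>x. N +>\<^bsub>M\<^esub> x) \<in> module_hom K M (quotient_module M N)"
    and quotient_module_carrier: "carrier (quotient_module M N) = (\<lambda>x. N +>\<^bsub>M\<^esub> x) ` carrier M"
    and quotient_proj_eq_iff: "\<And>x y. x \<in> carrier M \<Longrightarrow> y \<in> carrier M \<Longrightarrow>
      x \<in> N +>\<^bsub>M\<^esub> y \<longleftrightarrow> x \<ominus>\<^bsub>M\<^esub> y \<in> N"
    and quotient_proj_self: "\<And>x. x \<in> carrier M \<Longrightarrow> x \<in> N +>\<^bsub>M\<^esub> x"
    and quotient_proj_subset: "\<And>x. x \<in> carrier M \<Longrightarrow> N +>\<^bsub>M\<^esub> x \<subseteq> carrier M"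
    and quotient_proj_eqI: "\<And>x y. x \<in> carrier M \<Longrightarrow> y \<in> carrier M \<Longrightarrow> x \<ominus>\<^bsub>M\<^esub> y \<in> N \<Longrightarrow>
      N +>\<^bsub>M\<^esub> x = N +>\<^bsub>M\<^esub> y"
proof -
  interpret M: module K M by fact
  interpret N: submodule K N M by fact
  \<comment> \<open>Negatives are multiples by -1, which makes \<open>N\<close> an additive
    subgroup.\<close>
  have neg: "\<ominus>\<^bsub>M\<^esub> x \<in> N" if "x \<in> N" for x
  proof -
    have "x \<in> carrier M" using that N.subset by auto
    then show ?thesis
      using that N.smult_closed[of "\<ominus>\<^bsub>K\<^esub> \<one>\<^bsub>K\<^esub>" x] by (simp add: M.smult_l_minus)
  qed
  have sub: "subgroup N (add_monoid M)"
  proof (rule M.M.add.subgroupI)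
    show "N \<noteq> {}" using N.zero_closed by blast
  next
    fix x assume "x \<in> N"
    then show "\<ominus>\<^bsub>M\<^esub> x \<in> N" by (rule neg)
  qed (rule N.subset, rule N.m_closed)
  interpret N': abelian_subgroup N M
    by (intro abelian_subgroupI3 additive_subgroupI sub) (rule M.M.abelian_group_axioms)
  show iff: "x \<in> N +>\<^bsub>M\<^esub> y \<longleftrightarrow> x \<ominus>\<^bsub>M\<^esub> y \<in> N" if "x \<in> carrier M" "y \<in> carrier M" for x y
    using N'.a_rcos_module[OF that(2,1)] by (simp add: a_minus_def)
  show self: "x \<in> N +>\<^bsub>M\<^esub> x" if "x \<in> carrier M" for x
    using N'.a_rcos_self that by simp
  show subs: "N +>\<^bsub>M\<^esub> x \<subseteq> carrier M" if "x \<in> carrier M" for x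
    using N'.a_elemrcos_carrier that by auto
  show eqI: "N +>\<^bsub>M\<^esub> x = N +>\<^bsub>M\<^esub> y" if "x \<in> carrier M" "y \<in> carrier M" "x \<ominus>\<^bsub>M\<^esub> y \<in> N" for x y
    using N'.a_repr_independence'[of x y] iff that by simp
  let ?P = "quotient_module M N"
  let ?p = "\<lambda>x. N +>\<^bsub>M\<^esub> x"
  show carr: "carrier ?P = ?p ` carrier M"
    by (auto simp: quotient_module_def A_RCOSETS_def' )
  have add: "?p x \<oplus>\<^bsub>?P\<^esub> ?p y = ?p (x \<oplus>\<^bsub>M\<^esub> y)" if "x \<in> carrier M" "y \<in> carrier M" for x y
    using that by (simp add: quotient_module_def N'.a_rcos_sum)
  have smult: "r \<odot>\<^bsub>?P\<^esub> ?p x = ?p (r \<odot>\<^bsub>M\<^esub> x)" if "x \<in> carrier M" "r \<in> carrier K" for r x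
  proof -
    \<comment> \<open>All members of the coset yield the same coset after scaling, so the union in
      \<open>quotient_module\<close> is a union of equal sets; it is nonempty because the coset
      contains \<open>x\<close>.\<close>
    have "?p (r \<odot>\<^bsub>M\<^esub> y) = ?p (r \<odot>\<^bsub>M\<^esub> x)" if y: "y \<in> ?p x" for y
    proof (rule eqI)
      have yM: "y \<in> carrier M" using subs[OF \<open>x \<in> carrier M\<close>] y by auto
      then show "r \<odot>\<^bsub>M\<^esub> y \<in> carrier M" "r \<odot>\<^bsub>M\<^esub> x \<in> carrier M"
        using \<open>x \<in> carrier M\<close> \<open>r \<in> carrier K\<close> by auto
      have "r \<odot>\<^bsub>M\<^esub> y \<ominus>\<^bsub>M\<^esub> r \<odot>\<^bsub>M\<^esub> x = r \<odot>\<^bsub>M\<^esub> (y \<ominus>\<^bsub>M\<^esub> x)"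
        using yM \<open>x \<in> carrier M\<close> \<open>r \<in> carrier K\<close>
        by (simp add: a_minus_def M.smult_r_distr M.smult_r_minus)
      then show "r \<odot>\<^bsub>M\<^esub> y \<ominus>\<^bsub>M\<^esub> r \<odot>\<^bsub>M\<^esub> x \<in> N"
        using iff[OF yM \<open>x \<in> carrier M\<close>] y \<open>r \<in> carrier K\<close> by auto
    qed
    then have "(\<Union>y\<in>?p x. ?p (r \<odot>\<^bsub>M\<^esub> y)) = (\<Union>y\<in>?p x. ?p (r \<odot>\<^bsub>M\<^esub> x))"
      by (intro SUP_cong refl)
    also have "\<dots> = ?p (r \<odot>\<^bsub>M\<^esub> x)" using self[OF \<open>x \<in> carrier M\<close>] by blast
    finally show ?thesis by (simp add: quotient_module_def)
  qed
  have zero: "\<zero>\<^bsub>?P\<^esub> = ?p \<zero>\<^bsub>M\<^esub>"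
    using N'.a_rcos_const[of "\<zero>\<^bsub>M\<^esub>"] by (simp add: quotient_module_def)
  show "?p \<in> module_hom K M ?P"
    by (rule module_homI) (auto simp: carr add smult)
  show "module K ?P"
  proof (rule module_criteria)
    show "\<forall>v\<in>carrier ?P. \<exists>n\<in>carrier ?P. v \<oplus>\<^bsub>?P\<^esub> n = \<zero>\<^bsub>?P\<^esub>"
    proof
      fix v assume "v \<in> carrier ?P"
      then obtain x where x: "x \<in> carrier M" "v = ?p x" by (auto simp: carr)
      then have "v \<oplus>\<^bsub>?P\<^esub> ?p (\<ominus>\<^bsub>M\<^esub> x) = \<zero>\<^bsub>?P\<^esub>" by (simp add: add zero M.M.r_neg)
      with x show "\<exists>n\<in>carrier ?P. v \<oplus>\<^bsub>?P\<^esub> n = \<zero>\<^bsub>?P\<^esub>" by (auto simp: carr)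
    qed
    show "cring K" by (rule M.R.cring_axioms)
    show "\<zero>\<^bsub>?P\<^esub> \<in> carrier ?P" by (auto simp: carr zero)
  qed (auto simp: carr add smult zero M.M.a_ac M.smult_assoc1
      M.smult_l_distr M.smult_r_distr)
qed


section \<open>Free modules\<close>

lemma free_space_carrier:
  "cring K \<Longrightarrow> carrier (free_space K S) = {f \<in> S \<rightarrow>\<^sub>E carrier K. finite {s \<in> S. f s \<noteq> \<zero>\<^bsub>K\<^esub>}}"
  by (simp add: free_space_def ring.func_space_def cring.axioms)

lemma free_space_simps:
  assumes "cring K"
  shows "f \<oplus>\<^bsub>free_space K S\<^esub> g = (\<lambda>s\<in>S. f s \<oplus>\<^bsub>K\<^esub> g s)"
    and "r \<odot>\<^bsub>free_space K S\<^esub> f = (\<lambda>s\<in>S. r \<otimes>\<^bsub>K\<^esub> f s)"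
    and "\<zero>\<^bsub>free_space K S\<^esub> = (\<lambda>s\<in>S. \<zero>\<^bsub>K\<^esub>)"
  using assms by (simp_all add: free_space_def ring.func_space_def cring.axioms)

lemma free_space_module:
  assumes "cring K"
  shows "module K (free_space K S)"
proof -
  interpret cring K by fact
  interpret F: module K "func_space S" by (rule func_space_is_module)
  show ?thesis
    unfolding free_space_def
  proof (rule F.submodule_is_module, unfold_locales)
    fix v w assume vw: "v \<in> {f \<in> carrier (func_space S). finite {s \<in> S. f s \<noteq> \<zero>\<^bsub>K\<^esub>}}"
      "w \<in> {f \<in> carrier (func_space S). finite {s \<in> S. f s \<noteq> \<zero>\<^bsub>K\<^esub>}}"
    have "{s \<in> S. (v \<oplus>\<^bsub>func_space S\<^esub> w) s \<noteq> \<zero>\<^bsub>K\<^esub>} \<subseteq> {s \<in> S. v s \<noteq> \<zero>\<^bsub>K\<^esub>} \<union> {s \<in> S. w s \<noteq> \<zero>\<^bsub>K\<^esub>}"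
      by (auto simp: func_space_def)
    then have "finite {s \<in> S. (v \<oplus>\<^bsub>func_space S\<^esub> w) s \<noteq> \<zero>\<^bsub>K\<^esub>}"
      using vw by (blast intro: finite_subset)
    then show "v \<oplus>\<^bsub>func_space S\<^esub> w \<in> {f \<in> carrier (func_space S). finite {s \<in> S. f s \<noteq> \<zero>\<^bsub>K\<^esub>}}"
      using vw by simp
  next
    fix c v assume cv: "c \<in> carrier K" "v \<in> {f \<in> carrier (func_space S). finite {s \<in> S. f s \<noteq> \<zero>\<^bsub>K\<^esub>}}"
    have "{s \<in> S. (c \<odot>\<^bsub>func_space S\<^esub> v) s \<noteq> \<zero>\<^bsub>K\<^esub>} \<subseteq> {s \<in> S. v s \<noteq> \<zero>\<^bsub>K\<^esub>}"
      using cv by (auto simp: func_space_def)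
    then have "finite {s \<in> S. (c \<odot>\<^bsub>func_space S\<^esub> v) s \<noteq> \<zero>\<^bsub>K\<^esub>}"
      using cv by (blast intro: finite_subset)
    then show "c \<odot>\<^bsub>func_space S\<^esub> v \<in> {f \<in> carrier (func_space S). finite {s \<in> S. f s \<noteq> \<zero>\<^bsub>K\<^esub>}}"
      using cv by simp
  qed (auto simp: func_space_def cong: conj_cong)
qed

lemma free_gen_closed:
  assumes "cring K"
  shows "free_gen K S s \<in> carrier (free_space K S)"
proof -
  interpret cring K by fact
  have "{t \<in> S. (\<lambda>t\<in>S. if t = s then \<one>\<^bsub>K\<^esub> else \<zero>\<^bsub>K\<^esub>) t \<noteq> \<zero>\<^bsub>K\<^esub>} \<subseteq> {s}" by auto
  then have "finite {t \<in> S. (\<lambda>t\<in>S. if t = s then \<one>\<^bsub>K\<^esub> else \<zero>\<^bsub>K\<^esub>) t \<noteq> \<zero>\<^bsub>K\<^esub>}"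
    by (rule finite_subset) simp
  then show ?thesis
    by (simp add: free_space_carrier[OF assms] free_gen_def)
qed

text \<open>The induction is on a finite set bounding the support, with the function left arbitrary:
  splitting off the value at one point \<open>t\<close> as a multiple of a generator leaves a
  function supported in the smaller bound.\<close>

lemma free_space_hom_eqI:
  assumes W: "module K W"
    and h: "h \<in> module_hom K (free_space K S) W" and g: "g \<in> module_hom K (free_space K S) W"
    and gen: "\<And>s. s \<in> S \<Longrightarrow> h (free_gen K S s) = g (free_gen K S s)"
    and f: "f \<in> carrier (free_space K S)"
  shows "h f = g f"
proof -
  interpret W: module K W by fact
  let ?F = "free_space K S"
  have K: "cring K" by (rule W.R.cring_axioms)
  interpret F: module K ?F by (rule free_space_module[OF K])
  have "\<forall>f \<in> carrier ?F. {s \<in> S. f s \<noteq> \<zero>\<^bsub>K\<^esub>} \<subseteq> B \<longrightarrow> h f = g f" if "finite B" "B \<subseteq> S" for B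
    using that
  proof (induction B)
    case empty
    show ?case
    proof (intro ballI impI)
      fix f assume "f \<in> carrier ?F" "{s \<in> S. f s \<noteq> \<zero>\<^bsub>K\<^esub>} \<subseteq> {}"
      then have "f = \<zero>\<^bsub>?F\<^esub>"
        by (auto simp: free_space_carrier[OF K] free_space_simps[OF K] PiE_def extensional_def fun_eq_iff)
      then show "h f = g f"
        using module_hom_zero[OF F.module_axioms W h] module_hom_zero[OF F.module_axioms W g] by simp
    qed
  next
    case (insert t B)
    show ?case
    proof (intro ballI impI)
      fix f assume f: "f \<in> carrier ?F" and sub: "{s \<in> S. f s \<noteq> \<zero>\<^bsub>K\<^esub>} \<subseteq> insert t B"
      define f' where "f' = f(t := \<zero>\<^bsub>K\<^esub>)"
      have t: "t \<in> S" using insert.prems by simp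
      have fE: "f \<in> S \<rightarrow>\<^sub>E carrier K" "finite {s \<in> S. f s \<noteq> \<zero>\<^bsub>K\<^esub>}"
        using f by (auto simp: free_space_carrier[OF K])
      then have ft: "f t \<in> carrier K" using t by auto
      have sub': "{s \<in> S. f' s \<noteq> \<zero>\<^bsub>K\<^esub>} \<subseteq> {s \<in> S. f s \<noteq> \<zero>\<^bsub>K\<^esub>}" by (auto simp: f'_def)
      have f': "f' \<in> carrier ?F"
        using fE t finite_subset[OF sub'] unfolding free_space_carrier[OF K]
        by (auto simp: f'_def PiE_def extensional_def)
      have eq: "f = f' \<oplus>\<^bsub>?F\<^esub> f t \<odot>\<^bsub>?F\<^esub> free_gen K S t"
        using fE t ft by (auto simp: free_space_simps[OF K] f'_def free_gen_def PiE_def extensional_def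
            fun_eq_iff Pi_iff)
      have "h f' = g f'"
      proof -
        have "{s \<in> S. f' s \<noteq> \<zero>\<^bsub>K\<^esub>} \<subseteq> B" using sub by (auto simp: f'_def)
        then show ?thesis using insert.IH insert.prems f' by blast
      qed
      then show "h f = g f"
        using gen[OF t] f' ft free_gen_closed[OF K, of S t]
        by (subst (1 2) eq) (simp add: module_hom_add[OF h] module_hom_add[OF g]
            module_hom_smult[OF h] module_hom_smult[OF g])
    qed
  qed
  from this[of "{s \<in> S. f s \<noteq> \<zero>\<^bsub>K\<^esub>}"] f show ?thesis
    by (auto simp: free_space_carrier[OF K])
qed

text \<open>The same sum occurs in \<open>tensor_lift\<close>, where it is formed for every
  representative of a coset.\<close>

definition free_lift ::
  "('k, 'r) ring_scheme \<Rightarrow> 's set \<Rightarrow> ('k, 'w, 'z) module_scheme \<Rightarrow> ('s \<Rightarrow> 'w) \<Rightarrow> ('s \<Rightarrow> 'k) \<Rightarrow> 'w" where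
  "free_lift K S W b f = (\<Oplus>\<^bsub>W\<^esub>s\<in>{s \<in> S. f s \<noteq> \<zero>\<^bsub>K\<^esub>}. f s \<odot>\<^bsub>W\<^esub> b s)"

text \<open>The index set in \<open>free_lift\<close> depends on \<open>f\<close>, and supports can
  shrink under addition or scaling; a common finite superset is what allows sums to be compared
  termwise.\<close>

lemma free_lift_superset:
  assumes W: "module K W" and b: "b \<in> S \<rightarrow> carrier W" and f: "f \<in> S \<rightarrow> carrier K"
    and B: "finite B" "B \<subseteq> S" "{s \<in> S. f s \<noteq> \<zero>\<^bsub>K\<^esub>} \<subseteq> B"
  shows "free_lift K S W b f = (\<Oplus>\<^bsub>W\<^esub>s\<in>B. f s \<odot>\<^bsub>W\<^esub> b s)"
proof -
  interpret W: module K W by fact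
  show ?thesis
    unfolding free_lift_def
  proof (rule W.M.add.finprod_mono_neutral_cong_left)
    fix i assume "i \<in> B - {s \<in> S. f s \<noteq> \<zero>\<^bsub>K\<^esub>}"
    then have "i \<in> S" "f i = \<zero>\<^bsub>K\<^esub>" using B by auto
    then show "f i \<odot>\<^bsub>W\<^esub> b i = \<zero>\<^bsub>W\<^esub>" using b by (simp add: Pi_iff W.smult_l_null)
  qed (use assms in auto)
qed

lemma free_lift_hom:
  assumes W: "module K W" and b: "b \<in> S \<rightarrow> carrier W"
  shows "free_lift K S W b \<in> module_hom K (free_space K S) W"
proof -
  interpret W: module K W by fact
  have K: "cring K" by (rule W.R.cring_axioms)
  have cl: "f s \<odot>\<^bsub>W\<^esub> b s \<in> carrier W" if "f \<in> S \<rightarrow> carrier K" "s \<in> S" for f s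
    using that b by auto
  show ?thesis
  proof (rule module_homI)
    fix f assume f: "f \<in> carrier (free_space K S)"
    then show "free_lift K S W b f \<in> carrier W"
      unfolding free_lift_def
      using cl by (intro W.M.finsum_closed) (auto simp: free_space_carrier[OF K])
  next
    fix f g assume f: "f \<in> carrier (free_space K S)" and g: "g \<in> carrier (free_space K S)"
    define B where "B = {s \<in> S. f s \<noteq> \<zero>\<^bsub>K\<^esub>} \<union> {s \<in> S. g s \<noteq> \<zero>\<^bsub>K\<^esub>}"
    have B: "finite B" "B \<subseteq> S" using f g by (auto simp: B_def free_space_carrier[OF K])
    have f': "f \<in> S \<rightarrow> carrier K" and g': "g \<in> S \<rightarrow> carrier K"
      using f g by (auto simp: free_space_carrier[OF K])
    have "free_lift K S W b (f \<oplus>\<^bsub>free_space K S\<^esub> g) =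
        (\<Oplus>\<^bsub>W\<^esub>s\<in>B. (f \<oplus>\<^bsub>free_space K S\<^esub> g) s \<odot>\<^bsub>W\<^esub> b s)"
      using W b f' g' B by (intro free_lift_superset) (auto simp: free_space_simps[OF K] B_def)
    also have "\<dots> = (\<Oplus>\<^bsub>W\<^esub>s\<in>B. f s \<odot>\<^bsub>W\<^esub> b s \<oplus>\<^bsub>W\<^esub> g s \<odot>\<^bsub>W\<^esub> b s)"
      using f' g' b B by (intro W.M.finsum_cong')
        (auto simp: free_space_simps[OF K] Pi_iff subset_iff W.smult_l_distr)
    also have "\<dots> = (\<Oplus>\<^bsub>W\<^esub>s\<in>B. f s \<odot>\<^bsub>W\<^esub> b s) \<oplus>\<^bsub>W\<^esub> (\<Oplus>\<^bsub>W\<^esub>s\<in>B. g s \<odot>\<^bsub>W\<^esub> b s)"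
      using f' g' b B by (intro W.M.finsum_addf) (auto simp: Pi_iff subset_iff)
    also have "\<dots> = free_lift K S W b f \<oplus>\<^bsub>W\<^esub> free_lift K S W b g"
      using free_lift_superset[OF W b f' B] free_lift_superset[OF W b g' B] by (simp add: B_def)
    finally show "free_lift K S W b (f \<oplus>\<^bsub>free_space K S\<^esub> g) =
        free_lift K S W b f \<oplus>\<^bsub>W\<^esub> free_lift K S W b g" .
  next
    fix r f assume r: "r \<in> carrier K" and f: "f \<in> carrier (free_space K S)"
    define B where "B = {s \<in> S. f s \<noteq> \<zero>\<^bsub>K\<^esub>}"
    have B: "finite B" "B \<subseteq> S" using f by (auto simp: B_def free_space_carrier[OF K])
    have f': "f \<in> S \<rightarrow> carrier K" using f by (auto simp: free_space_carrier[OF K])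
    have "free_lift K S W b (r \<odot>\<^bsub>free_space K S\<^esub> f) =
        (\<Oplus>\<^bsub>W\<^esub>s\<in>B. (r \<odot>\<^bsub>free_space K S\<^esub> f) s \<odot>\<^bsub>W\<^esub> b s)"
      using W b f' r B by (intro free_lift_superset) (auto simp: free_space_simps[OF K] B_def Pi_iff)
    also have "\<dots> = (\<Oplus>\<^bsub>W\<^esub>s\<in>B. r \<odot>\<^bsub>W\<^esub> (f s \<odot>\<^bsub>W\<^esub> b s))"
      using f' b B r by (intro W.M.finsum_cong')
        (auto simp: free_space_simps[OF K] Pi_iff subset_iff W.smult_assoc1)
    also have "\<dots> = r \<odot>\<^bsub>W\<^esub> free_lift K S W b f"
      unfolding free_lift_def B_def[symmetric]
      using f' b B r by (intro W.finsum_smult_ldistr[symmetric]) (auto simp: Pi_iff subset_iff)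
    finally show "free_lift K S W b (r \<odot>\<^bsub>free_space K S\<^esub> f) = r \<odot>\<^bsub>W\<^esub> free_lift K S W b f" .
  qed
qed

lemma free_lift_gen:
  assumes W: "module K W" and b: "b \<in> S \<rightarrow> carrier W" and s: "s \<in> S"
  shows "free_lift K S W b (free_gen K S s) = b s"
proof -
  interpret W: module K W by fact
  have "free_lift K S W b (free_gen K S s) = (\<Oplus>\<^bsub>W\<^esub>t\<in>{s}. free_gen K S s t \<odot>\<^bsub>W\<^esub> b t)"
    using s by (intro free_lift_superset W b) (auto simp: free_gen_def)
  then show ?thesis using s b by (simp add: free_gen_def Pi_iff)
qed

section \<open>Bilinear maps and the universal property of the tensor product\<close>

definition bilinear_map ::
  "('k, 'r) ring_scheme \<Rightarrow> ('k, 'a, 'x) module_scheme \<Rightarrow> ('k, 'b, 'y) module_scheme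
    \<Rightarrow> ('k, 'w, 'z) module_scheme \<Rightarrow> ('a \<Rightarrow> 'b \<Rightarrow> 'w) \<Rightarrow> bool" where
  "bilinear_map K A B W \<beta> \<longleftrightarrow>
     (\<forall>b \<in> carrier B. (\<lambda>a. \<beta> a b) \<in> module_hom K A W) \<and>
     (\<forall>a \<in> carrier A. (\<lambda>b. \<beta> a b) \<in> module_hom K B W)"

lemma bilinear_mapI:
  assumes "\<And>b. b \<in> carrier B \<Longrightarrow> (\<lambda>a. \<beta> a b) \<in> module_hom K A W"
    and "\<And>a. a \<in> carrier A \<Longrightarrow> (\<lambda>b. \<beta> a b) \<in> module_hom K B W"
  shows "bilinear_map K A B W \<beta>"
  using assms by (auto simp: bilinear_map_def)

lemma bilinear_mapD:
  assumes "bilinear_map K A B W \<beta>"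
  shows "b \<in> carrier B \<Longrightarrow> (\<lambda>a. \<beta> a b) \<in> module_hom K A W"
    and "a \<in> carrier A \<Longrightarrow> (\<lambda>b. \<beta> a b) \<in> module_hom K B W"
  using assms by (auto simp: bilinear_map_def)

lemma bilinear_map_in:
  "bilinear_map K A B W \<beta> \<Longrightarrow> a \<in> carrier A \<Longrightarrow> b \<in> carrier B \<Longrightarrow> \<beta> a b \<in> carrier W"
  by (rule module_hom_in[OF bilinear_mapD(2)])

lemma bilinear_map_post:
  assumes "bilinear_map K A B W \<beta>" "h \<in> module_hom K W V"
  shows "bilinear_map K A B V (\<lambda>a b. h (\<beta> a b))"
  by (intro bilinear_mapI module_hom_compose[OF bilinear_mapD(1)[OF assms(1)] assms(2)]
      module_hom_compose[OF bilinear_mapD(2)[OF assms(1)] assms(2)])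

lemma bilinear_map_pre:
  assumes \<beta>: "bilinear_map K A' B' W \<beta>" and f: "f \<in> module_hom K A A'" and g: "g \<in> module_hom K B B'"
  shows "bilinear_map K A B W (\<lambda>a b. \<beta> (f a) (g b))"
proof (rule bilinear_mapI)
  fix b assume "b \<in> carrier B"
  then show "(\<lambda>a. \<beta> (f a) (g b)) \<in> module_hom K A W"
    using module_hom_compose[OF f bilinear_mapD(1)[OF \<beta> module_hom_in[OF g]]] by simp
next
  fix a assume "a \<in> carrier A"
  then show "(\<lambda>b. \<beta> (f a) (g b)) \<in> module_hom K B W"
    using module_hom_compose[OF g bilinear_mapD(2)[OF \<beta> module_hom_in[OF f]]] by simp
qed

lemma bilinear_map_swap: "bilinear_map K A B W \<beta> \<Longrightarrow> bilinear_map K B A W (\<lambda>b a. \<beta> a b)"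
  by (auto simp: bilinear_map_def)

lemma bilinear_map_plus:
  assumes "module K W" "bilinear_map K A B W \<beta>" "bilinear_map K A B W \<gamma>"
  shows "bilinear_map K A B W (\<lambda>a b. \<beta> a b \<oplus>\<^bsub>W\<^esub> \<gamma> a b)"
  using assms by (auto simp: bilinear_map_def intro!: module_hom_plus_fun)

lemma bilinear_map_minus:
  assumes "module K W" "bilinear_map K A B W \<beta>" "bilinear_map K A B W \<gamma>"
  shows "bilinear_map K A B W (\<lambda>a b. \<beta> a b \<ominus>\<^bsub>W\<^esub> \<gamma> a b)"
  using assms by (auto simp: bilinear_map_def intro!: module_hom_minus_fun)

context
  fixes K :: "('k, 'r) ring_scheme" and A :: "('k, 'a, 'x) module_scheme"
    and B :: "('k, 'b, 'y) module_scheme"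
  assumes A: "module K A" and B: "module K B"
begin

interpretation A: module K A by (rule A)
interpretation B: module K B by (rule B)

private abbreviation "S \<equiv> carrier A \<times> carrier B"
private abbreviation "F \<equiv> free_space K S"
private abbreviation "N \<equiv> relator_space K A B"
private abbreviation "\<delta> \<equiv> free_gen K S"

interpretation F: module K F by (rule free_space_module[OF A.R.cring_axioms])

private lemma gen_closed [simp]: "\<delta> s \<in> carrier F"
  by (rule free_gen_closed[OF A.R.cring_axioms])

private lemma relators_closed: "bilinear_relators K A B \<subseteq> carrier F"
  by (auto simp: bilinear_relators_def Let_def)

private lemma relator_submodule: "submodule K N F"
  unfolding relator_space_def by (rule F.span_is_submodule[OF relators_closed])

private lemma relators_subset: "bilinear_relators K A B \<subseteq> N"
  unfolding relator_space_def by (rule F.in_own_span[OF relators_closed])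

private lemmas quot = quotient_module[OF F.module_axioms relator_submodule, folded tensor_def]

lemma tensor_module: "module K (tensor K A B)"
  by (rule quot(1))

interpretation T: module K "tensor K A B" by (rule tensor_module)

private lemma proj_hom: "(\<lambda>x. N +>\<^bsub>F\<^esub> x) \<in> module_hom K F (tensor K A B)"
  by (rule quot(2))

private lemma pure_eq: "pure_tensor K A B a b = N +>\<^bsub>F\<^esub> \<delta> (a, b)"
  by (simp add: pure_tensor_def)

text \<open>Both kinds of additivity relators have the shape x - y - z, so this serves either slot
  of the tensor.\<close>

private lemma proj_eq_plus:
  assumes "x \<in> carrier F" "y \<in> carrier F" "z \<in> carrier F" "x \<ominus>\<^bsub>F\<^esub> y \<ominus>\<^bsub>F\<^esub> z \<in> N"
  shows "N +>\<^bsub>F\<^esub> x = (N +>\<^bsub>F\<^esub> y) \<oplus>\<^bsub>tensor K A B\<^esub> (N +>\<^bsub>F\<^esub> z)"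
proof -
  have "x \<ominus>\<^bsub>F\<^esub> (y \<oplus>\<^bsub>F\<^esub> z) = x \<ominus>\<^bsub>F\<^esub> y \<ominus>\<^bsub>F\<^esub> z"
    using assms by (simp add: a_minus_def F.M.minus_add F.M.a_assoc)
  then have "N +>\<^bsub>F\<^esub> x = N +>\<^bsub>F\<^esub> (y \<oplus>\<^bsub>F\<^esub> z)"
    using assms by (intro quot(7)) auto
  then show ?thesis using module_hom_add[OF proj_hom] assms by simp
qed

lemma pure_tensor_bilinear: "bilinear_map K A B (tensor K A B) (pure_tensor K A B)"
proof (intro bilinear_mapI module_homI)
  fix a b assume "a \<in> carrier A" "b \<in> carrier B"
  then show "pure_tensor K A B a b \<in> carrier (tensor K A B)"
    unfolding pure_eq by (intro module_hom_in[OF proj_hom]) simp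
  then show "pure_tensor K A B a b \<in> carrier (tensor K A B)" .
next
  fix a a' b assume "a \<in> carrier A" "a' \<in> carrier A" "b \<in> carrier B"
  then have "\<delta> (a \<oplus>\<^bsub>A\<^esub> a', b) \<ominus>\<^bsub>F\<^esub> \<delta> (a, b) \<ominus>\<^bsub>F\<^esub> \<delta> (a', b) \<in> bilinear_relators K A B"
    unfolding bilinear_relators_def Let_def by blast
  then show "pure_tensor K A B (a \<oplus>\<^bsub>A\<^esub> a') b =
      pure_tensor K A B a b \<oplus>\<^bsub>tensor K A B\<^esub> pure_tensor K A B a' b"
    unfolding pure_eq using relators_subset by (intro proj_eq_plus) auto
next
  fix a b b' assume "a \<in> carrier A" "b \<in> carrier B" "b' \<in> carrier B"
  then have "\<delta> (a, b \<oplus>\<^bsub>B\<^esub> b') \<ominus>\<^bsub>F\<^esub> \<delta> (a, b) \<ominus>\<^bsub>F\<^esub> \<delta> (a, b') \<in> bilinear_relators K A B"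
    unfolding bilinear_relators_def Let_def by blast
  then show "pure_tensor K A B a (b \<oplus>\<^bsub>B\<^esub> b') =
      pure_tensor K A B a b \<oplus>\<^bsub>tensor K A B\<^esub> pure_tensor K A B a b'"
    unfolding pure_eq using relators_subset by (intro proj_eq_plus) auto
next
  fix r a b assume *: "r \<in> carrier K" "a \<in> carrier A" "b \<in> carrier B"
  then have "\<delta> (r \<odot>\<^bsub>A\<^esub> a, b) \<ominus>\<^bsub>F\<^esub> r \<odot>\<^bsub>F\<^esub> \<delta> (a, b) \<in> bilinear_relators K A B"
    unfolding bilinear_relators_def Let_def by blast
  then have "N +>\<^bsub>F\<^esub> \<delta> (r \<odot>\<^bsub>A\<^esub> a, b) = N +>\<^bsub>F\<^esub> (r \<odot>\<^bsub>F\<^esub> \<delta> (a, b))"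
    using relators_subset * by (intro quot(7)) auto
  then show "pure_tensor K A B (r \<odot>\<^bsub>A\<^esub> a) b = r \<odot>\<^bsub>tensor K A B\<^esub> pure_tensor K A B a b"
    using * by (simp add: pure_eq module_hom_smult[OF proj_hom])
next
  fix r a b assume *: "r \<in> carrier K" "a \<in> carrier A" "b \<in> carrier B"
  then have "\<delta> (a, r \<odot>\<^bsub>B\<^esub> b) \<ominus>\<^bsub>F\<^esub> r \<odot>\<^bsub>F\<^esub> \<delta> (a, b) \<in> bilinear_relators K A B"
    unfolding bilinear_relators_def Let_def by blast
  then have "N +>\<^bsub>F\<^esub> \<delta> (a, r \<odot>\<^bsub>B\<^esub> b) = N +>\<^bsub>F\<^esub> (r \<odot>\<^bsub>F\<^esub> \<delta> (a, b))"
    using relators_subset * by (intro quot(7)) auto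
  then show "pure_tensor K A B a (r \<odot>\<^bsub>B\<^esub> b) = r \<odot>\<^bsub>tensor K A B\<^esub> pure_tensor K A B a b"
    using * by (simp add: pure_eq module_hom_smult[OF proj_hom])
qed

lemma pure_tensor_closed:
  "a \<in> carrier A \<Longrightarrow> b \<in> carrier B \<Longrightarrow> pure_tensor K A B a b \<in> carrier (tensor K A B)"
  by (rule bilinear_map_in[OF pure_tensor_bilinear])

text \<open>A linear map on the quotient is determined by its composite with the projection, and
  that composite by its values on the free generators, whose cosets are the pure tensors.\<close>

lemma tensor_hom_eqI:
  assumes W: "module K W"
    and h: "h \<in> module_hom K (tensor K A B) W" and g: "g \<in> module_hom K (tensor K A B) W"
    and pure: "\<And>a b. a \<in> carrier A \<Longrightarrow> b \<in> carrier B \<Longrightarrow>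
      h (pure_tensor K A B a b) = g (pure_tensor K A B a b)"
    and X: "X \<in> carrier (tensor K A B)"
  shows "h X = g X"
proof -
  obtain f where f: "f \<in> carrier F" "X = N +>\<^bsub>F\<^esub> f"
    using X unfolding quot(3) by auto
  have "h (N +>\<^bsub>F\<^esub> f) = g (N +>\<^bsub>F\<^esub> f)"
  proof (rule free_space_hom_eqI[OF W module_hom_compose[OF proj_hom h]
        module_hom_compose[OF proj_hom g] _ f(1)])
    fix s assume "s \<in> S"
    then obtain a b where "a \<in> carrier A" "b \<in> carrier B" "s = (a, b)" by blast
    then show "h (N +>\<^bsub>F\<^esub> \<delta> s) = g (N +>\<^bsub>F\<^esub> \<delta> s)" using pure unfolding pure_eq by blast
  qed
  with f show ?thesis by simp
qed

context
  fixes W :: "('k, 'w, 'z) module_scheme" and \<beta> :: "'a \<Rightarrow> 'b \<Rightarrow> 'w"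
  assumes W: "module K W" and \<beta>: "bilinear_map K A B W \<beta>"
begin

interpretation W: module K W by (rule W)

private abbreviation "L \<equiv> free_lift K S W (\<lambda>p. \<beta> (fst p) (snd p))"

private lemma beta_closed: "(\<lambda>p. \<beta> (fst p) (snd p)) \<in> S \<rightarrow> carrier W"
  using bilinear_map_in[OF \<beta>] by auto

private lemma L_hom: "L \<in> module_hom K F W"
  by (rule free_lift_hom[OF W beta_closed])

private lemma L_gen: "a \<in> carrier A \<Longrightarrow> b \<in> carrier B \<Longrightarrow> L (\<delta> (a, b)) = \<beta> a b"
  by (simp add: free_lift_gen[OF W beta_closed])

interpretation L: mod_hom K F W L
  by unfold_locales (rule L_hom)

text \<open>Bilinearity of \<open>\<beta>\<close> kills the four kinds of relators, and the kernel
  of \<open>L\<close> is a submodule, hence contains their span.\<close>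

private lemma L_relator:
  assumes "x \<in> N" shows "L x = \<zero>\<^bsub>W\<^esub>"
proof -
  have cancel: "(x \<oplus>\<^bsub>W\<^esub> y) \<ominus>\<^bsub>W\<^esub> x \<ominus>\<^bsub>W\<^esub> y = \<zero>\<^bsub>W\<^esub>" if "x \<in> carrier W" "y \<in> carrier W" for x y
  proof -
    have "(x \<oplus>\<^bsub>W\<^esub> y) \<ominus>\<^bsub>W\<^esub> x \<ominus>\<^bsub>W\<^esub> y = (x \<oplus>\<^bsub>W\<^esub> y) \<oplus>\<^bsub>W\<^esub> \<ominus>\<^bsub>W\<^esub> (x \<oplus>\<^bsub>W\<^esub> y)"
      using that by (simp add: a_minus_def W.M.minus_add W.M.a_assoc)
    then show ?thesis using that by (simp add: W.M.r_neg)
  qed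
  have self_cancel: "x \<ominus>\<^bsub>W\<^esub> x = \<zero>\<^bsub>W\<^esub>" if "x \<in> carrier W" for x
    using that by (simp add: a_minus_def W.M.r_neg)
  have "bilinear_relators K A B \<subseteq> L.ker"
    unfolding bilinear_relators_def Let_def L.ker_def
    using bilinear_mapD[OF \<beta>, THEN module_hom_add] bilinear_mapD[OF \<beta>, THEN module_hom_smult]
    by (auto simp: L_gen cancel self_cancel bilinear_map_in[OF \<beta>])
  then have "N \<subseteq> L.ker"
    unfolding relator_space_def by (rule F.span_is_subset[OF _ L.ker_is_submodule])
  with assms show ?thesis by (auto simp: L.ker_def)
qed

text \<open>The definite description in \<open>tensor_lift\<close> ranges over all representatives.
  Existence holds because representatives differ by elements of \<open>N\<close>, on which
  \<open>L\<close> vanishes; uniqueness holds because the coset contains \<open>f\<close>.\<close>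

private lemma tensor_lift_coset:
  assumes f: "f \<in> carrier F"
  shows "tensor_lift K A B W \<beta> (N +>\<^bsub>F\<^esub> f) = L f"
proof -
  have L_eq: "L f = L x" if x: "x \<in> N +>\<^bsub>F\<^esub> f" for x
  proof -
    have xF: "x \<in> carrier F" using quot(6)[OF f] x by auto
    have "L (x \<ominus>\<^bsub>F\<^esub> f) = \<zero>\<^bsub>W\<^esub>" using quot(4)[OF xF f] x by (intro L_relator) simp
    then show ?thesis using xF f by (simp add: W.M.minus_equality)
  qed
  have "tensor_lift K A B W \<beta> (N +>\<^bsub>F\<^esub> f) = (THE w. \<forall>x \<in> N +>\<^bsub>F\<^esub> f. w = L x)"
    unfolding tensor_lift_def free_lift_def ..
  also have "\<dots> = L f"
  proof (rule the_equality)
    show "\<forall>x \<in> N +>\<^bsub>F\<^esub> f. L f = L x" using L_eq by blast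
    show "w = L f" if "\<forall>x \<in> N +>\<^bsub>F\<^esub> f. w = L x" for w using that quot(5)[OF f] by blast
  qed
  finally show ?thesis .
qed

lemma tensor_lift_pure:
  "a \<in> carrier A \<Longrightarrow> b \<in> carrier B \<Longrightarrow>
    tensor_lift K A B W \<beta> (pure_tensor K A B a b) = \<beta> a b"
  unfolding pure_eq by (simp add: tensor_lift_coset L_gen)

lemma tensor_lift_hom: "tensor_lift K A B W \<beta> \<in> module_hom K (tensor K A B) W"
proof (rule module_homI)
  fix X assume "X \<in> carrier (tensor K A B)"
  then show "tensor_lift K A B W \<beta> X \<in> carrier W"
    unfolding quot(3) by (auto simp: tensor_lift_coset)
next
  fix X Y assume "X \<in> carrier (tensor K A B)" "Y \<in> carrier (tensor K A B)"
  then show "tensor_lift K A B W \<beta> (X \<oplus>\<^bsub>tensor K A B\<^esub> Y) =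
      tensor_lift K A B W \<beta> X \<oplus>\<^bsub>W\<^esub> tensor_lift K A B W \<beta> Y"
    unfolding quot(3) by (auto simp: tensor_lift_coset module_hom_add[OF proj_hom, symmetric])
next
  fix r X assume "r \<in> carrier K" "X \<in> carrier (tensor K A B)"
  then show "tensor_lift K A B W \<beta> (r \<odot>\<^bsub>tensor K A B\<^esub> X) = r \<odot>\<^bsub>W\<^esub> tensor_lift K A B W \<beta> X"
    unfolding quot(3) by (auto simp: tensor_lift_coset module_hom_smult[OF proj_hom, symmetric])
qed

lemma tensor_lift_closed: "X \<in> carrier (tensor K A B) \<Longrightarrow> tensor_lift K A B W \<beta> X \<in> carrier W"
  by (rule module_hom_in[OF tensor_lift_hom])

text \<open>The source of the rewriting rules for \<open>tensor_lift\<close> below: each is obtained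
  by checking a candidate linear map on pure tensors.\<close>

lemma tensor_lift_unique:
  assumes "h \<in> module_hom K (tensor K A B) W"
    and "\<And>a b. a \<in> carrier A \<Longrightarrow> b \<in> carrier B \<Longrightarrow> h (pure_tensor K A B a b) = \<beta> a b"
    and "X \<in> carrier (tensor K A B)"
  shows "tensor_lift K A B W \<beta> X = h X"
  by (rule tensor_hom_eqI[OF W tensor_lift_hom assms(1) _ assms(3)]) (simp add: tensor_lift_pure assms(2))

end

end

section \<open>Rewriting rules for induced maps: the Sweedler calculus\<close>

lemma bilinear_map_cong:
  assumes "module K A" "module K B" "bilinear_map K A B W \<gamma>"
    and "\<And>a b. a \<in> carrier A \<Longrightarrow> b \<in> carrier B \<Longrightarrow> \<beta> a b = \<gamma> a b"
  shows "bilinear_map K A B W \<beta>"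
proof (rule bilinear_mapI)
  fix b assume "b \<in> carrier B"
  then show "(\<lambda>a. \<beta> a b) \<in> module_hom K A W"
    using assms(4) by (intro module_hom_cong[OF assms(1) _ bilinear_mapD(1)[OF assms(3)]]) auto
next
  fix a assume "a \<in> carrier A"
  then show "(\<lambda>b. \<beta> a b) \<in> module_hom K B W"
    using assms(4) by (intro module_hom_cong[OF assms(2) _ bilinear_mapD(2)[OF assms(3)]]) auto
qed

lemma module_hom_tensor_lift:
  assumes A: "module K A" and B: "module K B" and W: "module K W" and V: "module K V"
    and \<beta>: "bilinear_map K A B W \<beta>" and h: "h \<in> module_hom K W V"
    and X: "X \<in> carrier (tensor K A B)"
  shows "h (tensor_lift K A B W \<beta> X) = tensor_lift K A B V (\<lambda>a b. h (\<beta> a b)) X"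
  using X
  by (intro tensor_lift_unique[OF A B V bilinear_map_post[OF \<beta> h], symmetric])
    (auto intro: module_hom_compose[OF tensor_lift_hom[OF A B W \<beta>] h]
      simp: tensor_lift_pure[OF A B W \<beta>])

text \<open>Bilinearity is asked of one side and transferred to the other, which spares a separate
  proof for the intermediate expressions that arise in rewriting.\<close>

lemma tensor_lift_cong:
  assumes A: "module K A" and B: "module K B" and W: "module K W"
    and \<gamma>: "bilinear_map K A B W \<gamma>"
    and eq: "\<And>a b. a \<in> carrier A \<Longrightarrow> b \<in> carrier B \<Longrightarrow> \<beta> a b = \<gamma> a b"
    and X: "X \<in> carrier (tensor K A B)"
  shows "tensor_lift K A B W \<beta> X = tensor_lift K A B W \<gamma> X"
  by (rule tensor_lift_unique[OF A B W bilinear_map_cong[OF A B \<gamma> eq] tensor_lift_hom[OF A B W \<gamma>] _ X])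
    (simp_all add: eq tensor_lift_pure[OF A B W \<gamma>])

lemma tensor_lift_plus:
  assumes A: "module K A" and B: "module K B" and W: "module K W"
    and \<beta>: "bilinear_map K A B W \<beta>" and \<gamma>: "bilinear_map K A B W \<gamma>"
    and X: "X \<in> carrier (tensor K A B)"
  shows "tensor_lift K A B W (\<lambda>a b. \<beta> a b \<oplus>\<^bsub>W\<^esub> \<gamma> a b) X =
    tensor_lift K A B W \<beta> X \<oplus>\<^bsub>W\<^esub> tensor_lift K A B W \<gamma> X"
  by (rule tensor_lift_unique[OF A B W bilinear_map_plus[OF W \<beta> \<gamma>]
        module_hom_plus_fun[OF W tensor_lift_hom[OF A B W \<beta>] tensor_lift_hom[OF A B W \<gamma>]] _ X])
    (simp add: tensor_lift_pure[OF A B W \<beta>] tensor_lift_pure[OF A B W \<gamma>])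

lemma tensor_lift_minus:
  assumes A: "module K A" and B: "module K B" and W: "module K W"
    and \<beta>: "bilinear_map K A B W \<beta>" and \<gamma>: "bilinear_map K A B W \<gamma>"
    and X: "X \<in> carrier (tensor K A B)"
  shows "tensor_lift K A B W (\<lambda>a b. \<beta> a b \<ominus>\<^bsub>W\<^esub> \<gamma> a b) X =
    tensor_lift K A B W \<beta> X \<ominus>\<^bsub>W\<^esub> tensor_lift K A B W \<gamma> X"
  by (rule tensor_lift_unique[OF A B W bilinear_map_minus[OF W \<beta> \<gamma>]
        module_hom_minus_fun[OF W tensor_lift_hom[OF A B W \<beta>] tensor_lift_hom[OF A B W \<gamma>]] _ X])
    (simp add: tensor_lift_pure[OF A B W \<beta>] tensor_lift_pure[OF A B W \<gamma>])

lemma bilinear_map_smult: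
  assumes "module K W" "bilinear_map K A B W \<beta>" "r \<in> carrier K"
  shows "bilinear_map K A B W (\<lambda>a b. r \<odot>\<^bsub>W\<^esub> \<beta> a b)"
  using assms by (auto simp: bilinear_map_def intro!: module_hom_smult_fun)

lemma tensor_lift_smult:
  assumes A: "module K A" and B: "module K B" and W: "module K W"
    and \<beta>: "bilinear_map K A B W \<beta>" and r: "r \<in> carrier K"
    and X: "X \<in> carrier (tensor K A B)"
  shows "tensor_lift K A B W (\<lambda>a b. r \<odot>\<^bsub>W\<^esub> \<beta> a b) X = r \<odot>\<^bsub>W\<^esub> tensor_lift K A B W \<beta> X"
  by (rule tensor_lift_unique[OF A B W bilinear_map_smult[OF W \<beta> r]
        module_hom_smult_fun[OF W tensor_lift_hom[OF A B W \<beta>] r] _ X])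
    (simp add: tensor_lift_pure[OF A B W \<beta>])

lemma bilinear_map_pure_map:
  assumes "module K A'" "module K B'" "f \<in> module_hom K A A'" "g \<in> module_hom K B B'"
  shows "bilinear_map K A B (tensor K A' B') (\<lambda>a b. pure_tensor K A' B' (f a) (g b))"
  by (rule bilinear_map_pre[OF pure_tensor_bilinear[OF assms(1,2)] assms(3,4)])

lemma tensor_map_hom:
  assumes "module K A" "module K B" "module K A'" "module K B'"
    and "f \<in> module_hom K A A'" "g \<in> module_hom K B B'"
  shows "tensor_map K A B A' B' f g \<in> module_hom K (tensor K A B) (tensor K A' B')"
  unfolding tensor_map_def
  by (intro tensor_lift_hom tensor_module bilinear_map_pure_map assms)

lemma tensor_map_pure:
  assumes "module K A" "module K B" "module K A'" "module K B'"
    and "f \<in> module_hom K A A'" "g \<in> module_hom K B B'" "a \<in> carrier A" "b \<in> carrier B"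
  shows "tensor_map K A B A' B' f g (pure_tensor K A B a b) = pure_tensor K A' B' (f a) (g b)"
  unfolding tensor_map_def
  using assms by (simp add: tensor_lift_pure tensor_module bilinear_map_pure_map)

lemma tensor_lift_tensor_map:
  assumes A: "module K A" and B: "module K B" and A': "module K A'" and B': "module K B'"
    and W: "module K W" and f: "f \<in> module_hom K A A'" and g: "g \<in> module_hom K B B'"
    and \<beta>: "bilinear_map K A' B' W \<beta>" and X: "X \<in> carrier (tensor K A B)"
  shows "tensor_lift K A' B' W \<beta> (tensor_map K A B A' B' f g X) =
    tensor_lift K A B W (\<lambda>a b. \<beta> (f a) (g b)) X"
  by (rule tensor_lift_unique[OF A B W bilinear_map_pre[OF \<beta> f g]
        module_hom_compose[OF tensor_map_hom[OF A B A' B' f g] tensor_lift_hom[OF A' B' W \<beta>]] _ X,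
        symmetric])
    (simp add: tensor_map_pure[OF A B A' B' f g] tensor_lift_pure[OF A' B' W \<beta>]
      module_hom_in[OF f] module_hom_in[OF g])


section \<open>Trilinear maps\<close>

text \<open>Two clauses cover all three slots: the first gives linearity in the first two arguments,
  the second in the last two.\<close>

definition trilinear_map ::
  "('k, 'r) ring_scheme \<Rightarrow> ('k, 'a, 'x) module_scheme \<Rightarrow> ('k, 'b, 'y) module_scheme
    \<Rightarrow> ('k, 'd, 'u) module_scheme \<Rightarrow> ('k, 'w, 'z) module_scheme
    \<Rightarrow> ('a \<Rightarrow> 'b \<Rightarrow> 'd \<Rightarrow> 'w) \<Rightarrow> bool" where
  "trilinear_map K A B D W F \<longleftrightarrow>
     (\<forall>d \<in> carrier D. bilinear_map K A B W (\<lambda>a b. F a b d)) \<and>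
     (\<forall>a \<in> carrier A. bilinear_map K B D W (\<lambda>b d. F a b d))"

lemma trilinear_mapD:
  assumes "trilinear_map K A B D W F"
  shows "d \<in> carrier D \<Longrightarrow> bilinear_map K A B W (\<lambda>a b. F a b d)"
    and "a \<in> carrier A \<Longrightarrow> bilinear_map K B D W (\<lambda>b d. F a b d)"
    and "b \<in> carrier B \<Longrightarrow> bilinear_map K A D W (\<lambda>a d. F a b d)"
  using assms unfolding trilinear_map_def bilinear_map_def by blast+

lemma trilinear_mapI:
  assumes "\<And>b d. b \<in> carrier B \<Longrightarrow> d \<in> carrier D \<Longrightarrow> (\<lambda>a. F a b d) \<in> module_hom K A W"
    and "\<And>a d. a \<in> carrier A \<Longrightarrow> d \<in> carrier D \<Longrightarrow> (\<lambda>b. F a b d) \<in> module_hom K B W"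
    and "\<And>a b. a \<in> carrier A \<Longrightarrow> b \<in> carrier B \<Longrightarrow> (\<lambda>d. F a b d) \<in> module_hom K D W"
  shows "trilinear_map K A B D W F"
  using assms unfolding trilinear_map_def bilinear_map_def by blast

lemma trilinear_map_in:
  "trilinear_map K A B D W F \<Longrightarrow> a \<in> carrier A \<Longrightarrow> b \<in> carrier B \<Longrightarrow> d \<in> carrier D \<Longrightarrow>
    F a b d \<in> carrier W"
  by (rule bilinear_map_in[OF trilinear_mapD(1)])

lemma trilinear_map_swap12:
  "trilinear_map K A B D W F \<Longrightarrow> trilinear_map K B A D W (\<lambda>b a d. F a b d)"
  unfolding trilinear_map_def bilinear_map_def by blast

lemma trilinear_map_swap23:
  "trilinear_map K A B D W F \<Longrightarrow> trilinear_map K A D B W (\<lambda>a d b. F a b d)"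
  unfolding trilinear_map_def bilinear_map_def by blast

lemma trilinear_map_plus:
  assumes "module K W" "trilinear_map K A B D W F" "trilinear_map K A B D W G"
  shows "trilinear_map K A B D W (\<lambda>a b d. F a b d \<oplus>\<^bsub>W\<^esub> G a b d)"
  using assms unfolding trilinear_map_def by (auto intro!: bilinear_map_plus)

lemma trilinear_map_minus:
  assumes "module K W" "trilinear_map K A B D W F" "trilinear_map K A B D W G"
  shows "trilinear_map K A B D W (\<lambda>a b d. F a b d \<ominus>\<^bsub>W\<^esub> G a b d)"
  using assms unfolding trilinear_map_def by (auto intro!: bilinear_map_minus)

lemma trilinear_map_pre:
  assumes F: "trilinear_map K A' B' D' W F" and f: "f \<in> module_hom K A A'"
    and g: "g \<in> module_hom K B B'" and h: "h \<in> module_hom K D D'"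
  shows "trilinear_map K A B D W (\<lambda>a b d. F (f a) (g b) (h d))"
  unfolding trilinear_map_def
  by (intro conjI ballI bilinear_map_pre[OF trilinear_mapD(1)[OF F module_hom_in[OF h]] f g]
    bilinear_map_pre[OF trilinear_mapD(2)[OF F module_hom_in[OF f]] g h])

text \<open>Linearity in \<open>e\<close> is composition with an induced map. In \<open>d\<close>
  the form itself varies, and linearity holds because the induced map depends linearly on its form.
  With \<open>f\<close> left general, both the identity and a comultiplication can be
  inserted.\<close>

lemma trilinear_map_tensor_lift_left:
  assumes A: "module K A" and B: "module K B" and W: "module K W"
    and F: "trilinear_map K A B D W F" and f: "f \<in> module_hom K E (tensor K A B)"
  shows "bilinear_map K E D W (\<lambda>e d. tensor_lift K A B W (\<lambda>a b. F a b d) (f e))"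
proof (intro bilinear_mapI)
  fix d assume d: "d \<in> carrier D"
  show "(\<lambda>e. tensor_lift K A B W (\<lambda>a b. F a b d) (f e)) \<in> module_hom K E W"
    by (rule module_hom_compose[OF f tensor_lift_hom[OF A B W trilinear_mapD(1)[OF F d]]])
next
  fix e assume e: "e \<in> carrier E"
  have fe: "f e \<in> carrier (tensor K A B)" by (rule module_hom_in[OF f e])
  note D = trilinear_mapD(1)[OF F] and hom = bilinear_mapD(2)[OF trilinear_mapD(2)[OF F]]
  show "(\<lambda>d. tensor_lift K A B W (\<lambda>a b. F a b d) (f e)) \<in> module_hom K D W"
  proof (rule module_homI)
    fix d assume d: "d \<in> carrier D"
    show "tensor_lift K A B W (\<lambda>a b. F a b d) (f e) \<in> carrier W"
      by (rule tensor_lift_closed[OF A B W D[OF d] fe])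
    fix d' assume d': "d' \<in> carrier D"
    show "tensor_lift K A B W (\<lambda>a b. F a b (d \<oplus>\<^bsub>D\<^esub> d')) (f e) =
        tensor_lift K A B W (\<lambda>a b. F a b d) (f e) \<oplus>\<^bsub>W\<^esub> tensor_lift K A B W (\<lambda>a b. F a b d') (f e)"
      unfolding tensor_lift_plus[OF A B W D[OF d] D[OF d'] fe, symmetric]
      by (rule tensor_lift_cong[OF A B W bilinear_map_plus[OF W D[OF d] D[OF d']] _ fe])
        (rule module_hom_add[OF hom d d'])
  next
    fix r d assume r: "r \<in> carrier K" and d: "d \<in> carrier D"
    show "tensor_lift K A B W (\<lambda>a b. F a b (r \<odot>\<^bsub>D\<^esub> d)) (f e) =
        r \<odot>\<^bsub>W\<^esub> tensor_lift K A B W (\<lambda>a b. F a b d) (f e)"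
      unfolding tensor_lift_smult[OF A B W D[OF d] r fe, symmetric]
      by (rule tensor_lift_cong[OF A B W bilinear_map_smult[OF W D[OF d] r] _ fe])
        (rule module_hom_smult[OF hom r d])
  qed
qed

lemma trilinear_map_tensor_lift_right:
  assumes B: "module K B" and D: "module K D" and W: "module K W"
    and F: "trilinear_map K A B D W F" and f: "f \<in> module_hom K E (tensor K B D)"
  shows "bilinear_map K A E W (\<lambda>a e. tensor_lift K B D W (\<lambda>b d. F a b d) (f e))"
  by (rule bilinear_map_swap[OF trilinear_map_tensor_lift_left[OF B D W _ f]])
    (rule trilinear_map_swap23[OF trilinear_map_swap12[OF F]])

lemma pure_tensor_trilinear:
  assumes A: "module K A" and B: "module K B" and D: "module K D"
  shows "trilinear_map K A B D (tensor K (tensor K A B) D)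
    (\<lambda>a b d. pure_tensor K (tensor K A B) D (pure_tensor K A B a b) d)"
proof -
  note p = pure_tensor_bilinear[OF A B]
  note q = pure_tensor_bilinear[OF tensor_module[OF A B] D]
  show ?thesis
  proof (rule trilinear_mapI)
    fix b d assume "b \<in> carrier B" "d \<in> carrier D"
    then show "(\<lambda>a. pure_tensor K (tensor K A B) D (pure_tensor K A B a b) d)
        \<in> module_hom K A (tensor K (tensor K A B) D)"
      by (intro module_hom_compose[OF bilinear_mapD(1)[OF p] bilinear_mapD(1)[OF q]])
  next
    fix a d assume "a \<in> carrier A" "d \<in> carrier D"
    then show "(\<lambda>b. pure_tensor K (tensor K A B) D (pure_tensor K A B a b) d)
        \<in> module_hom K B (tensor K (tensor K A B) D)"
      by (intro module_hom_compose[OF bilinear_mapD(2)[OF p] bilinear_mapD(1)[OF q]])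
  next
    fix a b assume "a \<in> carrier A" "b \<in> carrier B"
    then show "(\<lambda>d. pure_tensor K (tensor K A B) D (pure_tensor K A B a b) d)
        \<in> module_hom K D (tensor K (tensor K A B) D)"
      by (intro bilinear_mapD(2)[OF q] bilinear_map_in[OF p])
  qed
qed

lemma trilinear_lift_bilinear:
  assumes "module K B" "module K D" "module K W" "trilinear_map K A B D W F"
  shows "bilinear_map K A (tensor K B D) W (\<lambda>a. tensor_lift K B D W (F a))"
  using trilinear_map_tensor_lift_right[OF assms module_hom_id] by simp

lemma tensor_assoc_hom:
  assumes "module K A" "module K B" "module K D"
  shows "tensor_assoc K A B D \<in> module_hom K (tensor K A (tensor K B D)) (tensor K (tensor K A B) D)"
  unfolding tensor_assoc_def Let_def
  by (intro tensor_lift_hom trilinear_lift_bilinear tensor_module pure_tensor_trilinear assms)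

text \<open>\<open>tensor_assoc\<close> is a lift whose form is again a lift, so the outer map is
  pushed through twice, until only pure tensors remain. For a trilinear map, rebracketing thus means
  nesting the two lifts the other way.\<close>

lemma tensor_lift_tensor_assoc:
  assumes A: "module K A" and B: "module K B" and D: "module K D" and W: "module K W"
    and F: "trilinear_map K A B D W F" and X: "X \<in> carrier (tensor K A (tensor K B D))"
  shows "tensor_lift K (tensor K A B) D W (\<lambda>Y d. tensor_lift K A B W (\<lambda>a b. F a b d) Y)
      (tensor_assoc K A B D X) =
    tensor_lift K A (tensor K B D) W (\<lambda>a. tensor_lift K B D W (F a)) X"
proof -
  let ?V = "tensor K (tensor K A B) D"
  let ?P = "\<lambda>a b d. pure_tensor K (tensor K A B) D (pure_tensor K A B a b) d"
  note AB = tensor_module[OF A B] and BD = tensor_module[OF B D]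
  have V: "module K ?V" by (rule tensor_module[OF AB D])
  have bil: "bilinear_map K (tensor K A B) D W (\<lambda>Y d. tensor_lift K A B W (\<lambda>a b. F a b d) Y)"
    using trilinear_map_tensor_lift_left[OF A B W F module_hom_id] by simp
  let ?h = "tensor_lift K (tensor K A B) D W (\<lambda>Y d. tensor_lift K A B W (\<lambda>a b. F a b d) Y)"
  have h: "?h \<in> module_hom K ?V W" by (rule tensor_lift_hom[OF AB D W bil])
  note P = pure_tensor_trilinear[OF A B D]
  have hP: "?h (?P a b d) = F a b d" if "a \<in> carrier A" "b \<in> carrier B" "d \<in> carrier D" for a b d
    using that
    by (simp add: tensor_lift_pure[OF AB D W bil] pure_tensor_closed[OF A B]
        tensor_lift_pure[OF A B W trilinear_mapD(1)[OF F]])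
  have "?h (tensor_assoc K A B D X) =
      tensor_lift K A (tensor K B D) W (\<lambda>a Y. ?h (tensor_lift K B D ?V (?P a) Y)) X"
    unfolding tensor_assoc_def Let_def
    by (rule module_hom_tensor_lift[OF A BD V W trilinear_lift_bilinear[OF B D V P] h X])
  also have "\<dots> = tensor_lift K A (tensor K B D) W (\<lambda>a. tensor_lift K B D W (F a)) X"
  proof (rule tensor_lift_cong[OF A BD W trilinear_lift_bilinear[OF B D W F] _ X])
    fix a Y assume a: "a \<in> carrier A" and Y: "Y \<in> carrier (tensor K B D)"
    have "?h (tensor_lift K B D ?V (?P a) Y) = tensor_lift K B D W (\<lambda>b d. ?h (?P a b d)) Y"
      by (rule module_hom_tensor_lift[OF B D V W trilinear_mapD(2)[OF P a] h Y])
    also have "\<dots> = tensor_lift K B D W (F a) Y"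
      by (rule tensor_lift_cong[OF B D W trilinear_mapD(2)[OF F a] hP[OF a] Y])
    finally show "?h (tensor_lift K B D ?V (?P a) Y) = tensor_lift K B D W (F a) Y" .
  qed
  finally show ?thesis .
qed

section \<open>Maps out of threefold tensor products\<close>

definition tensor_lift3 ::
  "('k, 'r) ring_scheme \<Rightarrow> ('k, 'a, 'x) module_scheme \<Rightarrow> ('k, 'b, 'y) module_scheme
    \<Rightarrow> ('k, 'd, 'u) module_scheme \<Rightarrow> ('k, 'w, 'z) module_scheme
    \<Rightarrow> ('a \<Rightarrow> 'b \<Rightarrow> 'd \<Rightarrow> 'w) \<Rightarrow> (('a \<times> 'b \<Rightarrow> 'k) set \<times> 'd \<Rightarrow> 'k) set \<Rightarrow> 'w" where
  "tensor_lift3 K A B D W F =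
     tensor_lift K (tensor K A B) D W (\<lambda>X d. tensor_lift K A B W (\<lambda>a b. F a b d) X)"

lemma tensor_lift3_hom:
  assumes A: "module K A" and B: "module K B" and D: "module K D" and W: "module K W"
    and F: "trilinear_map K A B D W F"
  shows "tensor_lift3 K A B D W F \<in> module_hom K (tensor K (tensor K A B) D) W"
  unfolding tensor_lift3_def
  using trilinear_map_tensor_lift_left[OF A B W F module_hom_id]
  by (intro tensor_lift_hom tensor_module A B D W) simp

lemma tensor_lift3_pure:
  assumes A: "module K A" and B: "module K B" and D: "module K D" and W: "module K W"
    and F: "trilinear_map K A B D W F" and "a \<in> carrier A" "b \<in> carrier B" "d \<in> carrier D"
  shows "tensor_lift3 K A B D W F (pure_tensor K (tensor K A B) D (pure_tensor K A B a b) d) = F a b d"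
proof -
  have bil: "bilinear_map K (tensor K A B) D W (\<lambda>Y d. tensor_lift K A B W (\<lambda>a b. F a b d) Y)"
    using trilinear_map_tensor_lift_left[OF A B W F module_hom_id] by simp
  show ?thesis
    unfolding tensor_lift3_def
    using assms(6-8)
    by (simp add: tensor_lift_pure[OF tensor_module[OF A B] D W bil] pure_tensor_closed[OF A B]
        tensor_lift_pure[OF A B W trilinear_mapD(1)[OF F]])
qed

lemma tensor3_hom_eqI:
  assumes A: "module K A" and B: "module K B" and D: "module K D" and W: "module K W"
    and h: "h \<in> module_hom K (tensor K (tensor K A B) D) W"
    and g: "g \<in> module_hom K (tensor K (tensor K A B) D) W"
    and pure: "\<And>a b d. a \<in> carrier A \<Longrightarrow> b \<in> carrier B \<Longrightarrow> d \<in> carrier D \<Longrightarrow>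
      h (pure_tensor K (tensor K A B) D (pure_tensor K A B a b) d) =
      g (pure_tensor K (tensor K A B) D (pure_tensor K A B a b) d)"
    and Z: "Z \<in> carrier (tensor K (tensor K A B) D)"
  shows "h Z = g Z"
proof (rule tensor_hom_eqI[OF tensor_module[OF A B] D W h g _ Z])
  fix X d assume X: "X \<in> carrier (tensor K A B)" and d: "d \<in> carrier D"
  note p = bilinear_mapD(1)[OF pure_tensor_bilinear[OF tensor_module[OF A B] D] d]
  show "h (pure_tensor K (tensor K A B) D X d) = g (pure_tensor K (tensor K A B) D X d)"
    by (rule tensor_hom_eqI[OF A B W module_hom_compose[OF p h] module_hom_compose[OF p g] _ X])
      (rule pure[OF _ _ d])
qed


section \<open>Pre-Lie comodules in Sweedler form\<close>

text \<open>In Sweedler notation these are \<open>F(c, d, p)\<close> at \<open>(id \<otimes> \<rho>) \<rho> m = c \<otimes> d \<otimes> p\<close> and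
  \<open>F(a, b, n)\<close> at \<open>(\<Delta> \<otimes> id) \<rho> m = a \<otimes> b \<otimes> n\<close>.\<close>

definition iter_coaction ::
  "('k, 'r) ring_scheme \<Rightarrow> ('k, 'c, 'x) module_scheme \<Rightarrow> ('k, 'm, 'y) module_scheme
    \<Rightarrow> ('m \<Rightarrow> ('c \<times> 'm \<Rightarrow> 'k) set) \<Rightarrow> ('k, 'w, 'z) module_scheme
    \<Rightarrow> ('c \<Rightarrow> 'c \<Rightarrow> 'm \<Rightarrow> 'w) \<Rightarrow> 'm \<Rightarrow> 'w" where
  "iter_coaction K C M \<rho> W F m =
     tensor_lift K C M W (\<lambda>c n. tensor_lift K C M W (F c) (\<rho> n)) (\<rho> m)"

definition comult_coaction ::
  "('k, 'r) ring_scheme \<Rightarrow> ('k, 'c, 'x) module_scheme \<Rightarrow> ('c \<Rightarrow> ('c \<times> 'c \<Rightarrow> 'k) set)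
    \<Rightarrow> ('k, 'm, 'y) module_scheme
    \<Rightarrow> ('m \<Rightarrow> ('c \<times> 'm \<Rightarrow> 'k) set) \<Rightarrow> ('k, 'w, 'z) module_scheme
    \<Rightarrow> ('c \<Rightarrow> 'c \<Rightarrow> 'm \<Rightarrow> 'w) \<Rightarrow> 'm \<Rightarrow> 'w" where
  "comult_coaction K C \<Delta> M \<rho> W F m =
     tensor_lift K C M W (\<lambda>c n. tensor_lift K C C W (\<lambda>a b. F a b n) (\<Delta> c)) (\<rho> m)"

context
  fixes K :: "('k, 'r) ring_scheme" and C :: "('k, 'c, 'x) module_scheme"
    and M :: "('k, 'm, 'y) module_scheme"
    and \<Delta> :: "'c \<Rightarrow> ('c \<times> 'c \<Rightarrow> 'k) set" and \<rho> :: "'m \<Rightarrow> ('c \<times> 'm \<Rightarrow> 'k) set"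
  assumes C: "module K C" and M: "module K M"
    and \<Delta>: "\<Delta> \<in> module_hom K C (tensor K C C)" and \<rho>: "\<rho> \<in> module_hom K M (tensor K C M)"
begin

private lemmas CC = tensor_module[OF C C]
private lemmas CM = tensor_module[OF C M]
private lemmas CCM = tensor_module[OF CC M]

text \<open>Here and in the rest of this context \<open>\<Delta>\<close> and \<open>\<rho>\<close>
  are only assumed linear, not coassociative, so the results apply both to the given maps and to the
  derived ones.\<close>

lemma tensor_lift3_coaction:
  assumes W: "module K W" and F: "trilinear_map K C C M W F" and m: "m \<in> carrier M"
  shows "tensor_lift3 K C C M W F
      (tensor_assoc K C C M (tensor_map K C M C (tensor K C M) id \<rho> (\<rho> m))) =
    iter_coaction K C M \<rho> W F m"
proof -
  have X: "\<rho> m \<in> carrier (tensor K C M)" by (rule module_hom_in[OF \<rho> m])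
  have Y: "tensor_map K C M C (tensor K C M) id \<rho> (\<rho> m) \<in> carrier (tensor K C (tensor K C M))"
    by (rule module_hom_in[OF tensor_map_hom[OF C M C CM module_hom_id \<rho>] X])
  show ?thesis
    unfolding tensor_lift3_def iter_coaction_def
    by (simp add: tensor_lift_tensor_assoc[OF C C M W F Y]
        tensor_lift_tensor_map[OF C M C CM W module_hom_id \<rho> trilinear_lift_bilinear[OF C M W F] X])
qed

lemma tensor_lift3_comult:
  assumes W: "module K W" and F: "trilinear_map K C C M W F" and m: "m \<in> carrier M"
  shows "tensor_lift3 K C C M W F (tensor_map K C M (tensor K C C) M \<Delta> id (\<rho> m)) =
    comult_coaction K C \<Delta> M \<rho> W F m"
proof -
  have X: "\<rho> m \<in> carrier (tensor K C M)" by (rule module_hom_in[OF \<rho> m])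
  have bil: "bilinear_map K (tensor K C C) M W (\<lambda>Y d. tensor_lift K C C W (\<lambda>a b. F a b d) Y)"
    using trilinear_map_tensor_lift_left[OF C C W F module_hom_id] by simp
  show ?thesis
    unfolding tensor_lift3_def comult_coaction_def
    by (simp add: tensor_lift_tensor_map[OF C M CC M W \<Delta> module_hom_id bil X])
qed

lemma bilinear_iter_coaction:
  assumes W: "module K W" and F: "trilinear_map K C C M W F"
  shows "bilinear_map K C M W (\<lambda>c n. tensor_lift K C M W (F c) (\<rho> n))"
  by (rule trilinear_map_tensor_lift_right[OF C M W F \<rho>])

lemma bilinear_comult_coaction:
  assumes W: "module K W" and F: "trilinear_map K C C M W F"
  shows "bilinear_map K C M W (\<lambda>c n. tensor_lift K C C W (\<lambda>a b. F a b n) (\<Delta> c))"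
  by (rule trilinear_map_tensor_lift_left[OF C C W F \<Delta>])

lemma iter_coaction_minus:
  assumes W: "module K W" and F: "trilinear_map K C C M W F" and G: "trilinear_map K C C M W G"
    and m: "m \<in> carrier M"
  shows "iter_coaction K C M \<rho> W (\<lambda>a b n. F a b n \<ominus>\<^bsub>W\<^esub> G a b n) m =
    iter_coaction K C M \<rho> W F m \<ominus>\<^bsub>W\<^esub> iter_coaction K C M \<rho> W G m"
  unfolding iter_coaction_def
    tensor_lift_minus[OF C M W bilinear_iter_coaction[OF W F] bilinear_iter_coaction[OF W G]
      module_hom_in[OF \<rho> m], symmetric]
  by (rule tensor_lift_cong[OF C M W bilinear_map_minus[OF W bilinear_iter_coaction[OF W F]
          bilinear_iter_coaction[OF W G]] _ module_hom_in[OF \<rho> m]])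
    (intro tensor_lift_minus[OF C M W] trilinear_mapD(2)[OF F] trilinear_mapD(2)[OF G] module_hom_in[OF \<rho>])

lemma iter_coaction_cong:
  assumes W: "module K W" and G: "trilinear_map K C C M W G"
    and eq: "\<And>a b n. a \<in> carrier C \<Longrightarrow> b \<in> carrier C \<Longrightarrow> n \<in> carrier M \<Longrightarrow> F a b n = G a b n"
    and m: "m \<in> carrier M"
  shows "iter_coaction K C M \<rho> W F m = iter_coaction K C M \<rho> W G m"
  unfolding iter_coaction_def
  by (rule tensor_lift_cong[OF C M W bilinear_iter_coaction[OF W G] _ module_hom_in[OF \<rho> m]])
    (rule tensor_lift_cong[OF C M W trilinear_mapD(2)[OF G] _ module_hom_in[OF \<rho>]], auto intro: eq)

lemma comodule_coassociator_closed:
  assumes m: "m \<in> carrier M"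
  shows "tensor_assoc K C C M (tensor_map K C M C (tensor K C M) id \<rho> (\<rho> m))
      \<in> carrier (tensor K (tensor K C C) M)" (is "?x \<in> _")
    and "tensor_map K C M (tensor K C C) M \<Delta> id (\<rho> m) \<in> carrier (tensor K (tensor K C C) M)"
      (is "?y \<in> _")
    and "comodule_coassociator K C \<Delta> M \<rho> m \<in> carrier (tensor K (tensor K C C) M)"
proof -
  interpret CCM: module K "tensor K (tensor K C C) M" by (rule CCM)
  have X: "\<rho> m \<in> carrier (tensor K C M)" by (rule module_hom_in[OF \<rho> m])
  show x: "?x \<in> carrier (tensor K (tensor K C C) M)"
    by (rule module_hom_in[OF tensor_assoc_hom[OF C C M]
          module_hom_in[OF tensor_map_hom[OF C M C CM module_hom_id \<rho>] X]])
  show y: "?y \<in> carrier (tensor K (tensor K C C) M)"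
    by (rule module_hom_in[OF tensor_map_hom[OF C M CC M \<Delta> module_hom_id] X])
  show "comodule_coassociator K C \<Delta> M \<rho> m \<in> carrier (tensor K (tensor K C C) M)"
    unfolding comodule_coassociator_def using x y by simp
qed

lemma tensor_swap_hom: "tensor_swap K C C \<in> module_hom K (tensor K C C) (tensor K C C)"
  unfolding tensor_swap_def
  by (rule tensor_lift_hom[OF C C CC bilinear_map_swap[OF pure_tensor_bilinear[OF C C]]])

lemma tensor_swap_pure:
  "a \<in> carrier C \<Longrightarrow> b \<in> carrier C \<Longrightarrow> tensor_swap K C C (pure_tensor K C C a b) = pure_tensor K C C b a"
  unfolding tensor_swap_def
  by (rule tensor_lift_pure[OF C C CC bilinear_map_swap[OF pure_tensor_bilinear[OF C C]]])

text \<open>The difference of the coassociator and its swap is the value of one induced map, that of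
  the form taking a, b, n to a \<otimes> b \<otimes> n - b \<otimes> a \<otimes> n. Hence the target
  of the test maps can be the threefold tensor product itself; the premise retains of this form only
  trilinearity and the sign change.\<close>

lemma pre_Lie_comodule_conditionI:
  assumes eq: "\<And>H. trilinear_map K C C M (tensor K (tensor K C C) M) H \<Longrightarrow>
      (\<And>a b n. a \<in> carrier C \<Longrightarrow> b \<in> carrier C \<Longrightarrow> n \<in> carrier M \<Longrightarrow>
        H b a n = \<ominus>\<^bsub>tensor K (tensor K C C) M\<^esub> H a b n) \<Longrightarrow>
      iter_coaction K C M \<rho> (tensor K (tensor K C C) M) H m =
      comult_coaction K C \<Delta> M \<rho> (tensor K (tensor K C C) M) H m"
    and m: "m \<in> carrier M"
  shows "comodule_coassociator K C \<Delta> M \<rho> m \<ominus>\<^bsub>tensor K (tensor K C C) M\<^esub>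
      tensor_map K (tensor K C C) M (tensor K C C) M (tensor_swap K C C) id
        (comodule_coassociator K C \<Delta> M \<rho> m)
    = \<zero>\<^bsub>tensor K (tensor K C C) M\<^esub>"
proof -
  let ?V = "tensor K (tensor K C C) M"
  let ?P = "\<lambda>a b n. pure_tensor K (tensor K C C) M (pure_tensor K C C a b) n"
  let ?S = "tensor_map K (tensor K C C) M (tensor K C C) M (tensor_swap K C C) id"
  interpret V: module K ?V by (rule CCM)
  \<comment> \<open>the universal alternating trilinear map\<close>
  define H where "H a b n = ?P a b n \<ominus>\<^bsub>?V\<^esub> ?P b a n" for a b n
  note P = pure_tensor_trilinear[OF C C M]
  have H: "trilinear_map K C C M ?V H"
    unfolding H_def by (rule trilinear_map_minus[OF CCM P trilinear_map_swap12[OF P]])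
  have Pcl: "?P a b n \<in> carrier ?V" if "a \<in> carrier C" "b \<in> carrier C" "n \<in> carrier M" for a b n
    by (rule trilinear_map_in[OF P that])
  have anti: "H b a n = \<ominus>\<^bsub>?V\<^esub> H a b n" if "a \<in> carrier C" "b \<in> carrier C" "n \<in> carrier M" for a b n
    using that Pcl[of a b n] Pcl[of b a n] unfolding H_def
    by (simp add: a_minus_def V.M.minus_add V.M.a_comm)
  have S: "?S \<in> module_hom K ?V ?V"
    by (rule tensor_map_hom[OF CC M CC M tensor_swap_hom module_hom_id])
  have id: "(\<lambda>Z. Z) \<in> module_hom K ?V ?V" using module_hom_id[of K ?V] by (simp add: id_def)
  have Z: "comodule_coassociator K C \<Delta> M \<rho> m \<in> carrier ?V"
    by (rule comodule_coassociator_closed(3)[OF m])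
  have "comodule_coassociator K C \<Delta> M \<rho> m \<ominus>\<^bsub>?V\<^esub> ?S (comodule_coassociator K C \<Delta> M \<rho> m) =
      tensor_lift3 K C C M ?V H (comodule_coassociator K C \<Delta> M \<rho> m)"
  proof (rule tensor3_hom_eqI[OF C C M CCM module_hom_minus_fun[OF CCM id S]
        tensor_lift3_hom[OF C C M CCM H] _ Z])
    fix a b n assume *: "a \<in> carrier C" "b \<in> carrier C" "n \<in> carrier M"
    then have "?S (?P a b n) = ?P b a n"
      using tensor_map_pure[OF CC M CC M tensor_swap_hom module_hom_id pure_tensor_closed[OF C C]]
      by (simp add: tensor_swap_pure)
    then show "?P a b n \<ominus>\<^bsub>?V\<^esub> ?S (?P a b n) = tensor_lift3 K C C M ?V H (?P a b n)"
      using tensor_lift3_pure[OF C C M CCM H *] by (simp add: H_def)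
  qed
  also have "\<dots> = iter_coaction K C M \<rho> ?V H m \<ominus>\<^bsub>?V\<^esub> comult_coaction K C \<Delta> M \<rho> ?V H m"
    unfolding comodule_coassociator_def
      module_hom_minus[OF CCM CCM tensor_lift3_hom[OF C C M CCM H] comodule_coassociator_closed(1)[OF m]
      comodule_coassociator_closed(2)[OF m]]
    by (simp only: tensor_lift3_coaction[OF CCM H m] tensor_lift3_comult[OF CCM H m])
  also have "\<dots> = \<zero>\<^bsub>?V\<^esub>"
  proof -
    have "comult_coaction K C \<Delta> M \<rho> ?V H m \<in> carrier ?V"
      unfolding comult_coaction_def
      by (rule tensor_lift_closed[OF C M CCM bilinear_comult_coaction[OF CCM H] module_hom_in[OF \<rho> m]])
    then show ?thesis using eq[OF H anti] by (simp add: a_minus_def V.M.r_neg)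
  qed
  finally show ?thesis .
qed

end

section \<open>The derived coaction\<close>

text \<open>The transpose of the operator Q \<otimes> id + id \<otimes> T - id on tensors. With the
  pure tensor as \<open>\<beta>\<close> it is the form defining \<rho>'; with T = Q it applies to C
  as a comodule over itself.\<close>

definition derived_form ::
  "('k, 'w, 'z) module_scheme \<Rightarrow> ('c \<Rightarrow> 'c) \<Rightarrow> ('m \<Rightarrow> 'm) \<Rightarrow> ('c \<Rightarrow> 'm \<Rightarrow> 'w) \<Rightarrow> 'c \<Rightarrow> 'm \<Rightarrow> 'w" where
  "derived_form W Q T \<beta> c n = \<beta> (Q c) n \<oplus>\<^bsub>W\<^esub> \<beta> c (T n) \<ominus>\<^bsub>W\<^esub> \<beta> c n"

lemma bilinear_map_pre_left:
  assumes "bilinear_map K A' B W \<beta>" "f \<in> module_hom K A A'"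
  shows "bilinear_map K A B W (\<lambda>a b. \<beta> (f a) b)"
  using bilinear_map_pre[OF assms module_hom_id] by simp

lemma bilinear_map_pre_right:
  assumes "bilinear_map K A B' W \<beta>" "g \<in> module_hom K B B'"
  shows "bilinear_map K A B W (\<lambda>a b. \<beta> a (g b))"
  using bilinear_map_pre[OF assms(1) module_hom_id assms(2)] by simp

lemma derived_form_bilinear:
  assumes W: "module K W" and Q: "Q \<in> module_hom K C C" and T: "T \<in> module_hom K M M"
    and \<beta>: "bilinear_map K C M W \<beta>"
  shows "bilinear_map K C M W (derived_form W Q T \<beta>)"
  using bilinear_map_minus[OF W bilinear_map_plus[OF W bilinear_map_pre_left[OF \<beta> Q]
        bilinear_map_pre_right[OF \<beta> T]] \<beta>]
  by (simp add: derived_form_def[abs_def])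

lemma pre_Lie_coaction_hom:
  assumes C: "module K C" and M: "module K M" and \<rho>: "\<rho> \<in> module_hom K M (tensor K C M)"
    and Q: "Q \<in> module_hom K C C" and T: "T \<in> module_hom K M M"
  shows "pre_Lie_coaction K C M \<rho> Q T \<in> module_hom K M (tensor K C M)"
  using module_hom_compose[OF \<rho> tensor_lift_hom[OF C M tensor_module[OF C M]
        derived_form_bilinear[OF tensor_module[OF C M] Q T pure_tensor_bilinear[OF C M]]]]
  by (simp add: pre_Lie_coaction_def[abs_def] derived_form_def[abs_def])

text \<open>\<rho>' is induced by the derived form of the universal bilinear map, so any other
  \<open>\<beta>\<close> is reached by composing with the linear map it induces.\<close>

lemma tensor_lift_pre_Lie_coaction:
  assumes C: "module K C" and M: "module K M" and W: "module K W"
    and \<rho>: "\<rho> \<in> module_hom K M (tensor K C M)"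
    and Q: "Q \<in> module_hom K C C" and T: "T \<in> module_hom K M M"
    and \<beta>: "bilinear_map K C M W \<beta>" and m: "m \<in> carrier M"
  shows "tensor_lift K C M W \<beta> (pre_Lie_coaction K C M \<rho> Q T m) =
    tensor_lift K C M W (derived_form W Q T \<beta>) (\<rho> m)"
proof -
  let ?t = "tensor K C M" and ?p = "pure_tensor K C M"
  note CM = tensor_module[OF C M]
  interpret CM: module K ?t by (rule CM)
  note p = pure_tensor_bilinear[OF C M]
  note h = tensor_lift_hom[OF C M W \<beta>]
  have "tensor_lift K C M W \<beta> (pre_Lie_coaction K C M \<rho> Q T m) =
      tensor_lift K C M W \<beta> (tensor_lift K C M ?t (derived_form ?t Q T ?p) (\<rho> m))"
    by (simp add: pre_Lie_coaction_def derived_form_def[abs_def])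
  also have "\<dots> = tensor_lift K C M W (\<lambda>c n. tensor_lift K C M W \<beta> (derived_form ?t Q T ?p c n)) (\<rho> m)"
    by (rule module_hom_tensor_lift[OF C M CM W derived_form_bilinear[OF CM Q T p] h module_hom_in[OF \<rho> m]])
  also have "\<dots> = tensor_lift K C M W (derived_form W Q T \<beta>) (\<rho> m)"
  proof (rule tensor_lift_cong[OF C M W derived_form_bilinear[OF W Q T \<beta>] _ module_hom_in[OF \<rho> m]])
    fix c n assume "c \<in> carrier C" "n \<in> carrier M"
    then show "tensor_lift K C M W \<beta> (derived_form ?t Q T ?p c n) = derived_form W Q T \<beta> c n"
      by (simp add: derived_form_def module_hom_minus[OF CM W h] module_hom_add[OF h]
          tensor_lift_pure[OF C M W \<beta>] bilinear_map_in[OF p] module_hom_in[OF Q] module_hom_in[OF T])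
  qed
  finally show ?thesis .
qed

section \<open>The Rota-Baxter condition and coassociativity in terms of forms\<close>

lemma vectorspace_module: "vectorspace K V \<Longrightarrow> module K V"
  by (simp add: vectorspace_def)

lemma Rota_Baxter_paired_comoduleD:
  assumes "Rota_Baxter_paired_comodule K C \<Delta> M \<rho> wt Q T"
  shows "module K C" "module K M" "\<Delta> \<in> module_hom K C (tensor K C C)"
    "\<rho> \<in> module_hom K M (tensor K C M)" "Q \<in> module_hom K C C" "T \<in> module_hom K M M"
proof -
  interpret Rota_Baxter_paired_comodule K C \<Delta> M \<rho> wt Q T by fact
  show "module K C" "module K M" by (intro vectorspace_module; unfold_locales)+
  show "\<Delta> \<in> module_hom K C (tensor K C C)" by (rule comult_linear)
  show "\<rho> \<in> module_hom K M (tensor K C M)" by (rule coaction_linear)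
  show "Q \<in> module_hom K C C" by (rule Q_linear)
  show "T \<in> module_hom K M M" by (rule T_linear)
qed

text \<open>With M = C, \<rho> = \<Delta> and T = Q the axioms coincide; this makes the Rota-Baxter
  step below applicable to the coproduct as well as to the coaction.\<close>

lemma Rota_Baxter_coalgebra_paired:
  assumes "Rota_Baxter_coalgebra K C \<Delta> wt Q"
  shows "Rota_Baxter_paired_comodule K C \<Delta> C \<Delta> wt Q Q"
proof -
  interpret Rota_Baxter_coalgebra K C \<Delta> wt Q by fact
  show ?thesis
    by unfold_locales
      (use comult_linear coassociative weight_closed operator_linear Rota_Baxter in auto)
qed

text \<open>The paired condition tested on \<open>\<beta>\<close>. Its right-hand side applies Q on
  the left, T on the right and \<lambda> times the identity, all at \<rho> (T m), and \<lambda> = -1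
  makes the sum exactly the derived form.\<close>

lemma derived_form_paired:
  assumes P: "Rota_Baxter_paired_comodule K C \<Delta> M \<rho> (\<ominus>\<^bsub>K\<^esub> \<one>\<^bsub>K\<^esub>) Q T"
    and W: "module K W" and \<beta>: "bilinear_map K C M W \<beta>" and m: "m \<in> carrier M"
  shows "tensor_lift K C M W (derived_form W Q T \<beta>) (\<rho> (T m)) =
    tensor_lift K C M W (\<lambda>c n. \<beta> (Q c) (T n)) (\<rho> m)"
proof -
  note C = Rota_Baxter_paired_comoduleD(1)[OF P] and M = Rota_Baxter_paired_comoduleD(2)[OF P]
    and \<rho> = Rota_Baxter_paired_comoduleD(4)[OF P] and Q = Rota_Baxter_paired_comoduleD(5)[OF P]
    and T = Rota_Baxter_paired_comoduleD(6)[OF P]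
  note CM = tensor_module[OF C M]
  interpret CM: module K "tensor K C M" by (rule CM)
  interpret W: module K W by (rule W)
  have Tm: "T m \<in> carrier M" by (rule module_hom_in[OF T m])
  have X: "\<rho> m \<in> carrier (tensor K C M)" and Y: "\<rho> (T m) \<in> carrier (tensor K C M)"
    by (rule module_hom_in[OF \<rho> m], rule module_hom_in[OF \<rho> Tm])
  note h = tensor_lift_hom[OF C M W \<beta>]
  note map_in = module_hom_in[OF tensor_map_hom[OF C M C M]]
  note lift_map = tensor_lift_tensor_map[OF C M C M W _ _ \<beta>]
  note bl = bilinear_map_pre_left[OF \<beta> Q] and br = bilinear_map_pre_right[OF \<beta> T]
  note closed = tensor_lift_closed[OF C M W _ Y]
  have "tensor_lift K C M W (\<lambda>c n. \<beta> (Q c) (T n)) (\<rho> m) =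
      tensor_lift K C M W \<beta> (tensor_map K C M C M Q T (\<rho> m))"
    by (rule lift_map[OF Q T X, symmetric])
  also have "\<dots> = tensor_lift K C M W \<beta> (
      tensor_map K C M C M Q id (\<rho> (T m)) \<oplus>\<^bsub>tensor K C M\<^esub>
      tensor_map K C M C M id T (\<rho> (T m)) \<oplus>\<^bsub>tensor K C M\<^esub>
      \<ominus>\<^bsub>K\<^esub> \<one>\<^bsub>K\<^esub> \<odot>\<^bsub>tensor K C M\<^esub> \<rho> (T m))"
    by (simp only: Rota_Baxter_paired_comodule.paired[OF P m])
  also have "\<dots> = tensor_lift K C M W (\<lambda>c n. \<beta> (Q c) n) (\<rho> (T m)) \<oplus>\<^bsub>W\<^esub>
      tensor_lift K C M W (\<lambda>c n. \<beta> c (T n)) (\<rho> (T m)) \<ominus>\<^bsub>W\<^esub>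
      tensor_lift K C M W \<beta> (\<rho> (T m))"
    using lift_map[OF Q module_hom_id Y] lift_map[OF module_hom_id T Y] closed[OF \<beta>]
    by (simp add: module_hom_add[OF h] module_hom_smult[OF h] map_in[OF Q module_hom_id Y]
        map_in[OF module_hom_id T Y] Y W.smult_l_minus a_minus_def)
  also have "\<dots> = tensor_lift K C M W (derived_form W Q T \<beta>) (\<rho> (T m))"
    unfolding derived_form_def[abs_def]
      tensor_lift_minus[OF C M W bilinear_map_plus[OF W bl br] \<beta> Y] tensor_lift_plus[OF C M W bl br Y] ..
  finally show ?thesis ..
qed

text \<open>Coassociativity of the given coaction in terms of forms: the two threefold tensors it
  equates are evaluated on \<open>F\<close> and become nested lifts.\<close>

lemma comult_eq_iter_coaction:
  assumes co: "left_comodule K C \<Delta> M \<rho>" and W: "module K W"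
    and F: "trilinear_map K C C M W F" and m: "m \<in> carrier M"
  shows "comult_coaction K C \<Delta> M \<rho> W F m = iter_coaction K C M \<rho> W F m"
proof -
  interpret left_comodule K C \<Delta> M \<rho> by fact
  have "module K C" "module K M" by (intro vectorspace_module; unfold_locales)+
  note * = this comult_linear coaction_linear W F m
  show ?thesis
    unfolding tensor_lift3_comult[OF *, symmetric] tensor_lift3_coaction[OF *, symmetric]
    by (simp only: coaction_coassociative[OF m])
qed

text \<open>The seven-term form to which both \<open>(id \<otimes> \<rho>') \<rho>'\<close> and, for alternating \<open>H\<close>,
  \<open>(\<Delta>' \<otimes> id) \<rho>'\<close> pull back \<open>H\<close>; one Rota-Baxter step has already been applied to the middle term.\<close>

definition derived_trilinear ::
  "('k, 'w, 'z) module_scheme \<Rightarrow> ('c \<Rightarrow> 'c) \<Rightarrow> ('m \<Rightarrow> 'm) \<Rightarrow> ('c \<Rightarrow> 'c \<Rightarrow> 'm \<Rightarrow> 'w) \<Rightarrow> 'c \<Rightarrow> 'c \<Rightarrow> 'm \<Rightarrow> 'w"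
  where
  "derived_trilinear W Q T H c d p =
     derived_form W Q T (H (Q c)) d p \<oplus>\<^bsub>W\<^esub> H c (Q d) (T p) \<ominus>\<^bsub>W\<^esub> derived_form W Q T (H c) d p"

lemma trilinear_map_pre1:
  assumes "trilinear_map K A' B D W F" "f \<in> module_hom K A A'"
  shows "trilinear_map K A B D W (\<lambda>a b d. F (f a) b d)"
  using trilinear_map_pre[OF assms module_hom_id module_hom_id] by simp

lemma trilinear_map_pre2:
  assumes "trilinear_map K A B' D W F" "f \<in> module_hom K B B'"
  shows "trilinear_map K A B D W (\<lambda>a b d. F a (f b) d)"
  using trilinear_map_pre[OF assms(1) module_hom_id assms(2) module_hom_id] by simp

lemma trilinear_map_pre3:
  assumes "trilinear_map K A B D' W F" "f \<in> module_hom K D D'"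
  shows "trilinear_map K A B D W (\<lambda>a b d. F a b (f d))"
  using trilinear_map_pre[OF assms(1) module_hom_id module_hom_id assms(2)] by simp

lemma derived_form_trilinear:
  assumes W: "module K W" and Q: "Q \<in> module_hom K C C" and T: "T \<in> module_hom K M M"
    and H: "trilinear_map K A C M W H"
  shows "trilinear_map K A C M W (\<lambda>a. derived_form W Q T (H a))"
  using trilinear_map_minus[OF W trilinear_map_plus[OF W trilinear_map_pre2[OF H Q]
        trilinear_map_pre3[OF H T]] H]
  by (simp add: derived_form_def[abs_def])

lemma derived_trilinear_trilinear:
  assumes W: "module K W" and Q: "Q \<in> module_hom K C C" and T: "T \<in> module_hom K M M"
    and H: "trilinear_map K C C M W H"
  shows "trilinear_map K C C M W (derived_trilinear W Q T H)"
proof -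
  note D = derived_form_trilinear[OF W Q T H]
  show ?thesis
    unfolding derived_trilinear_def[abs_def]
    by (rule trilinear_map_minus[OF W trilinear_map_plus[OF W trilinear_map_pre1[OF D Q]
            trilinear_map_pre2[OF trilinear_map_pre3[OF H T] Q]] D])
qed

text \<open>The outer derived form produces inner coactions at n, T n and n. To the one at T n
  \<open>derived_form_paired\<close> applies, and its three terms become
  \<open>H c (Q d) (T p)\<close>; the other two keep three terms each.\<close>

lemma iter_pre_Lie_coaction:
  assumes P: "Rota_Baxter_paired_comodule K C \<Delta> M \<rho> (\<ominus>\<^bsub>K\<^esub> \<one>\<^bsub>K\<^esub>) Q T"
    and W: "module K W" and H: "trilinear_map K C C M W H" and m: "m \<in> carrier M"
  shows "iter_coaction K C M (pre_Lie_coaction K C M \<rho> Q T) W H m =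
    iter_coaction K C M \<rho> W (derived_trilinear W Q T H) m"
proof -
  note C = Rota_Baxter_paired_comoduleD(1)[OF P] and M = Rota_Baxter_paired_comoduleD(2)[OF P]
    and \<Delta> = Rota_Baxter_paired_comoduleD(3)[OF P]
    and \<rho> = Rota_Baxter_paired_comoduleD(4)[OF P] and Q = Rota_Baxter_paired_comoduleD(5)[OF P]
    and T = Rota_Baxter_paired_comoduleD(6)[OF P]
  let ?\<rho> = "pre_Lie_coaction K C M \<rho> Q T"
  note \<rho>' = pre_Lie_coaction_hom[OF C M \<rho> Q T]
  let ?G = "\<lambda>c n. tensor_lift K C M W (H c) (?\<rho> n)"
  have G: "bilinear_map K C M W ?G" by (rule bilinear_iter_coaction[OF C M \<Delta> \<rho>' W H])
  note Hc = trilinear_mapD(2)[OF H]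
  note lift' = tensor_lift_pre_Lie_coaction[OF C M W \<rho> Q T]
  have "iter_coaction K C M ?\<rho> W H m = tensor_lift K C M W (derived_form W Q T ?G) (\<rho> m)"
    unfolding iter_coaction_def by (rule lift'[OF G m])
  also have "\<dots> = iter_coaction K C M \<rho> W (derived_trilinear W Q T H) m"
    unfolding iter_coaction_def
  proof (rule tensor_lift_cong[OF C M W
        bilinear_iter_coaction[OF C M \<Delta> \<rho> W derived_trilinear_trilinear[OF W Q T H]] _
        module_hom_in[OF \<rho> m]])
    fix c n assume c: "c \<in> carrier C" and n: "n \<in> carrier M"
    have Qc: "Q c \<in> carrier C" by (rule module_hom_in[OF Q c])
    have Tn: "T n \<in> carrier M" by (rule module_hom_in[OF T n])
    have X: "\<rho> n \<in> carrier (tensor K C M)" by (rule module_hom_in[OF \<rho> n])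
    note b1 = derived_form_bilinear[OF W Q T Hc[OF Qc]] and b2 = bilinear_map_pre[OF Hc[OF c] Q T]
      and b3 = derived_form_bilinear[OF W Q T Hc[OF c]]
    have "derived_form W Q T ?G c n =
        tensor_lift K C M W (derived_form W Q T (H (Q c))) (\<rho> n) \<oplus>\<^bsub>W\<^esub>
        tensor_lift K C M W (\<lambda>d p. H c (Q d) (T p)) (\<rho> n) \<ominus>\<^bsub>W\<^esub>
        tensor_lift K C M W (derived_form W Q T (H c)) (\<rho> n)"
      unfolding derived_form_def[of W Q T ?G]
      by (simp only: lift'[OF Hc[OF Qc] n] lift'[OF Hc[OF c] n] lift'[OF Hc[OF c] Tn]
          derived_form_paired[OF P W Hc[OF c] n])
    also have "\<dots> = tensor_lift K C M W (derived_trilinear W Q T H c) (\<rho> n)"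
      unfolding derived_trilinear_def[abs_def]
        tensor_lift_minus[OF C M W bilinear_map_plus[OF W b1 b2] b3 X] tensor_lift_plus[OF C M W b1 b2 X] ..
    finally show "derived_form W Q T ?G c n = tensor_lift K C M W (derived_trilinear W Q T H c) (\<rho> n)" .
  qed
  finally show ?thesis .
qed

section \<open>The derived comultiplication\<close>

text \<open>Plays for \<Delta>' the role that \<open>derived_form\<close> plays for \<rho>'; here
  one term exchanges the two arguments.\<close>

definition comult_form ::
  "('k, 'w, 'z) module_scheme \<Rightarrow> ('c \<Rightarrow> 'c) \<Rightarrow> ('c \<Rightarrow> 'c \<Rightarrow> 'w) \<Rightarrow> 'c \<Rightarrow> 'c \<Rightarrow> 'w" where
  "comult_form W Q \<beta> a b = \<beta> (Q a) b \<ominus>\<^bsub>W\<^esub> \<beta> (Q b) a \<ominus>\<^bsub>W\<^esub> \<beta> a b"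

lemma comult_form_bilinear:
  assumes W: "module K W" and Q: "Q \<in> module_hom K C C" and \<beta>: "bilinear_map K C C W \<beta>"
  shows "bilinear_map K C C W (comult_form W Q \<beta>)"
  using bilinear_map_minus[OF W bilinear_map_minus[OF W bilinear_map_pre_left[OF \<beta> Q]
        bilinear_map_swap[OF bilinear_map_pre_left[OF \<beta> Q]]] \<beta>]
  by (simp add: comult_form_def[abs_def])

lemma pre_Lie_comult_hom:
  assumes C: "module K C" and \<Delta>: "\<Delta> \<in> module_hom K C (tensor K C C)" and Q: "Q \<in> module_hom K C C"
  shows "pre_Lie_comult K C \<Delta> Q \<in> module_hom K C (tensor K C C)"
  using module_hom_compose[OF \<Delta> tensor_lift_hom[OF C C tensor_module[OF C C]
        comult_form_bilinear[OF tensor_module[OF C C] Q pure_tensor_bilinear[OF C C]]]]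
  by (simp add: pre_Lie_comult_def[abs_def] comult_form_def[abs_def])

lemma tensor_lift_pre_Lie_comult:
  assumes C: "module K C" and W: "module K W"
    and \<Delta>: "\<Delta> \<in> module_hom K C (tensor K C C)" and Q: "Q \<in> module_hom K C C"
    and \<beta>: "bilinear_map K C C W \<beta>" and c: "c \<in> carrier C"
  shows "tensor_lift K C C W \<beta> (pre_Lie_comult K C \<Delta> Q c) =
    tensor_lift K C C W (comult_form W Q \<beta>) (\<Delta> c)"
proof -
  let ?t = "tensor K C C" and ?p = "pure_tensor K C C"
  note CC = tensor_module[OF C C]
  interpret CC: module K ?t by (rule CC)
  note p = pure_tensor_bilinear[OF C C]
  note h = tensor_lift_hom[OF C C W \<beta>]
  have "tensor_lift K C C W \<beta> (pre_Lie_comult K C \<Delta> Q c) =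
      tensor_lift K C C W \<beta> (tensor_lift K C C ?t (comult_form ?t Q ?p) (\<Delta> c))"
    by (simp add: pre_Lie_comult_def comult_form_def[abs_def])
  also have "\<dots> = tensor_lift K C C W (\<lambda>a b. tensor_lift K C C W \<beta> (comult_form ?t Q ?p a b)) (\<Delta> c)"
    by (rule module_hom_tensor_lift[OF C C CC W comult_form_bilinear[OF CC Q p] h module_hom_in[OF \<Delta> c]])
  also have "\<dots> = tensor_lift K C C W (comult_form W Q \<beta>) (\<Delta> c)"
  proof (rule tensor_lift_cong[OF C C W comult_form_bilinear[OF W Q \<beta>] _ module_hom_in[OF \<Delta> c]])
    fix a b assume "a \<in> carrier C" "b \<in> carrier C"
    then show "tensor_lift K C C W \<beta> (comult_form ?t Q ?p a b) = comult_form W Q \<beta> a b"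
      by (simp add: comult_form_def module_hom_minus[OF CC W h]
          tensor_lift_pure[OF C C W \<beta>] bilinear_map_in[OF p] module_hom_in[OF Q])
  qed
  finally show ?thesis .
qed

text \<open>By antisymmetry the exchanged term, minus \<open>\<beta> (Q b) a\<close>, equals
  \<open>\<beta> a (Q b)\<close>; this is the only difference between the two forms.\<close>

lemma tensor_lift_pre_Lie_comult_alternating:
  assumes C: "module K C" and W: "module K W"
    and \<Delta>: "\<Delta> \<in> module_hom K C (tensor K C C)" and Q: "Q \<in> module_hom K C C"
    and \<beta>: "bilinear_map K C C W \<beta>" and c: "c \<in> carrier C"
    and anti: "\<And>a b. a \<in> carrier C \<Longrightarrow> b \<in> carrier C \<Longrightarrow> \<beta> b a = \<ominus>\<^bsub>W\<^esub> \<beta> a b"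
  shows "tensor_lift K C C W \<beta> (pre_Lie_comult K C \<Delta> Q c) =
    tensor_lift K C C W (derived_form W Q Q \<beta>) (\<Delta> c)"
proof -
  interpret W: module K W by (rule W)
  have "comult_form W Q \<beta> a b = derived_form W Q Q \<beta> a b" if "a \<in> carrier C" "b \<in> carrier C" for a b
    using that module_hom_in[OF Q] bilinear_map_in[OF \<beta>] anti[of a "Q b"]
    by (simp add: comult_form_def derived_form_def a_minus_def)
  then show ?thesis
    unfolding tensor_lift_pre_Lie_comult[OF C W \<Delta> Q \<beta> c]
    by (intro tensor_lift_cong[OF C C W derived_form_bilinear[OF W Q Q \<beta>] _ module_hom_in[OF \<Delta> c]])
qed

text \<open>Counterpart of \<open>iter_pre_Lie_coaction\<close> with the collapse elsewhere: the
  inner coproduct is evaluated at Q c, c and c, and the Rota-Baxter condition of C turns the three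
  terms at Q c into \<open>H (Q a) (Q b) n\<close>.\<close>

lemma comult_pre_Lie_coaction:
  assumes CQ: "Rota_Baxter_coalgebra K C \<Delta> (\<ominus>\<^bsub>K\<^esub> \<one>\<^bsub>K\<^esub>) Q"
    and P: "Rota_Baxter_paired_comodule K C \<Delta> M \<rho> (\<ominus>\<^bsub>K\<^esub> \<one>\<^bsub>K\<^esub>) Q T"
    and W: "module K W" and H: "trilinear_map K C C M W H" and m: "m \<in> carrier M"
    and anti: "\<And>a b n. a \<in> carrier C \<Longrightarrow> b \<in> carrier C \<Longrightarrow> n \<in> carrier M \<Longrightarrow>
      H b a n = \<ominus>\<^bsub>W\<^esub> H a b n"
  shows "comult_coaction K C (pre_Lie_comult K C \<Delta> Q) M (pre_Lie_coaction K C M \<rho> Q T) W H m =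
    comult_coaction K C \<Delta> M \<rho> W (derived_trilinear W Q T H) m"
proof -
  note C = Rota_Baxter_paired_comoduleD(1)[OF P] and M = Rota_Baxter_paired_comoduleD(2)[OF P]
    and \<Delta> = Rota_Baxter_paired_comoduleD(3)[OF P]
    and \<rho> = Rota_Baxter_paired_comoduleD(4)[OF P] and Q = Rota_Baxter_paired_comoduleD(5)[OF P]
    and T = Rota_Baxter_paired_comoduleD(6)[OF P]
  interpret W: module K W by (rule W)
  note PC = Rota_Baxter_coalgebra_paired[OF CQ]
  let ?\<Delta> = "pre_Lie_comult K C \<Delta> Q"
  note \<Delta>' = pre_Lie_comult_hom[OF C \<Delta> Q]
  let ?G = "\<lambda>c n. tensor_lift K C C W (\<lambda>a b. H a b n) (?\<Delta> c)"
  have G: "bilinear_map K C M W ?G" by (rule bilinear_comult_coaction[OF C M \<Delta>' \<rho> W H])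
  note Hn = trilinear_mapD(1)[OF H]
  note E = derived_trilinear_trilinear[OF W Q T H]
  have lift': "?G c n = tensor_lift K C C W (derived_form W Q Q (\<lambda>a b. H a b n)) (\<Delta> c)"
    if "c \<in> carrier C" "n \<in> carrier M" for c n
    by (rule tensor_lift_pre_Lie_comult_alternating[OF C W \<Delta> Q Hn[OF that(2)] that(1) anti[OF _ _ that(2)]])
  have "comult_coaction K C ?\<Delta> M (pre_Lie_coaction K C M \<rho> Q T) W H m =
      tensor_lift K C M W (derived_form W Q T ?G) (\<rho> m)"
    unfolding comult_coaction_def by (rule tensor_lift_pre_Lie_coaction[OF C M W \<rho> Q T G m])
  also have "\<dots> = comult_coaction K C \<Delta> M \<rho> W (derived_trilinear W Q T H) m"
    unfolding comult_coaction_def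
  proof (rule tensor_lift_cong[OF C M W bilinear_comult_coaction[OF C M \<Delta> \<rho> W E] _
        module_hom_in[OF \<rho> m]])
    fix c n assume c: "c \<in> carrier C" and n: "n \<in> carrier M"
    have Qc: "Q c \<in> carrier C" by (rule module_hom_in[OF Q c])
    have Tn: "T n \<in> carrier M" by (rule module_hom_in[OF T n])
    have X: "\<Delta> c \<in> carrier (tensor K C C)" by (rule module_hom_in[OF \<Delta> c])
    let ?b1 = "\<lambda>a b. H (Q a) (Q b) n" and ?b2 = "derived_form W Q Q (\<lambda>a b. H a b (T n))"
      and ?b3 = "derived_form W Q Q (\<lambda>a b. H a b n)"
    have b1: "bilinear_map K C C W ?b1" by (rule bilinear_map_pre[OF Hn[OF n] Q Q])
    note b2 = derived_form_bilinear[OF W Q Q Hn[OF Tn]] and b3 = derived_form_bilinear[OF W Q Q Hn[OF n]]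
    have "derived_form W Q T ?G c n =
        tensor_lift K C C W ?b1 (\<Delta> c) \<oplus>\<^bsub>W\<^esub> tensor_lift K C C W ?b2 (\<Delta> c) \<ominus>\<^bsub>W\<^esub>
        tensor_lift K C C W ?b3 (\<Delta> c)"
      unfolding derived_form_def[of W Q T ?G]
      by (simp only: lift'[OF Qc n] lift'[OF c Tn] lift'[OF c n] derived_form_paired[OF PC W Hn[OF n] c])
    also have "\<dots> = tensor_lift K C C W (\<lambda>a b. ?b1 a b \<oplus>\<^bsub>W\<^esub> ?b2 a b \<ominus>\<^bsub>W\<^esub> ?b3 a b) (\<Delta> c)"
      unfolding tensor_lift_minus[OF C C W bilinear_map_plus[OF W b1 b2] b3 X]
        tensor_lift_plus[OF C C W b1 b2 X] ..
    \<comment> \<open>The seven terms agree as they stand. They are grouped here as 1 + 3 - 3 and in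
      \<open>derived_trilinear\<close> as 3 + 1 - 3; no sign change of \<open>H\<close> is used at
      this point.\<close>
    also have "\<dots> = tensor_lift K C C W (\<lambda>a b. derived_trilinear W Q T H a b n) (\<Delta> c)"
    proof (rule tensor_lift_cong[OF C C W trilinear_mapD(1)[OF E n] _ X])
      fix a b assume "a \<in> carrier C" "b \<in> carrier C"
      then show "?b1 a b \<oplus>\<^bsub>W\<^esub> ?b2 a b \<ominus>\<^bsub>W\<^esub> ?b3 a b = derived_trilinear W Q T H a b n"
        using n Tn module_hom_in[OF Q] trilinear_map_in[OF H]
        by (simp add: derived_trilinear_def derived_form_def a_minus_def W.M.minus_add W.M.a_ac)
    qed
    finally show "derived_form W Q T ?G c n =
        tensor_lift K C C W (\<lambda>a b. derived_trilinear W Q T H a b n) (\<Delta> c)" .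
  qed
  finally show ?thesis .
qed

section \<open>The pre-Lie identity for the derived comultiplication\<close>

lemma comult_form_trilinear:
  assumes W: "module K W" and Q: "Q \<in> module_hom K C C" and H: "trilinear_map K A C C W H"
  shows "trilinear_map K A C C W (\<lambda>a. comult_form W Q (H a))"
  using trilinear_map_minus[OF W trilinear_map_minus[OF W trilinear_map_pre2[OF H Q]
        trilinear_map_swap23[OF trilinear_map_pre2[OF H Q]]] H]
  by (simp add: comult_form_def[abs_def])

text \<open>The seven atoms stand for values of \<open>H\<close> in the coalgebra case below, where
  \<open>v\<close> is \<open>H (Q x) (Q b) a\<close> and \<open>t\<close> is
  \<open>H x (Q b) a\<close>. These two cancel; the remaining five are the terms of \<open>U\<close>
  and \<open>V\<close>.\<close>

lemma (in abelian_group) pre_Lie_comult_cancel: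
  assumes "u \<in> carrier G" "v \<in> carrier G" "w \<in> carrier G" "s \<in> carrier G" "t \<in> carrier G"
    "z \<in> carrier G" "r \<in> carrier G"
  shows "(u \<ominus> v \<ominus> w) \<ominus> (s \<ominus> t \<ominus> z) \<ominus> (\<ominus> v \<ominus> \<ominus> r \<ominus> \<ominus> t) = u \<ominus> (w \<oplus> s \<ominus> z) \<ominus> r"
proof -
  have "(u \<ominus> v \<ominus> w) \<ominus> (s \<ominus> t \<ominus> z) \<ominus> (\<ominus> v \<ominus> \<ominus> r \<ominus> \<ominus> t) =
      (u \<ominus> (w \<oplus> s \<ominus> z) \<ominus> r) \<oplus> (v \<oplus> \<ominus> v) \<oplus> (t \<oplus> \<ominus> t)"
    using assms by (simp add: a_minus_def minus_add a_ac del: r_neg)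
  then show ?thesis using assms by (simp add: r_neg)
qed

text \<open>This is not an instance of the comodule computation: the derived coaction of \<open>C\<close> on itself is
  not \<open>\<Delta>'\<close>.  Coassociativity moves the terms with swapped arguments, \<open>V\<close> and \<open>R\<close> below, into the
  same iterated coproduct as the others.\<close>

lemma iter_eq_comult_pre_Lie_comult:
  assumes CQ: "Rota_Baxter_coalgebra K C \<Delta> (\<ominus>\<^bsub>K\<^esub> \<one>\<^bsub>K\<^esub>) Q"
    and W: "module K W" and H: "trilinear_map K C C C W H" and c: "c \<in> carrier C"
    and anti: "\<And>a b n. a \<in> carrier C \<Longrightarrow> b \<in> carrier C \<Longrightarrow> n \<in> carrier C \<Longrightarrow>
      H b a n = \<ominus>\<^bsub>W\<^esub> H a b n"
  shows "iter_coaction K C C (pre_Lie_comult K C \<Delta> Q) W H c =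
    comult_coaction K C (pre_Lie_comult K C \<Delta> Q) C (pre_Lie_comult K C \<Delta> Q) W H c"
proof -
  note P = Rota_Baxter_coalgebra_paired[OF CQ]
  note C = Rota_Baxter_paired_comoduleD(1)[OF P] and \<Delta> = Rota_Baxter_paired_comoduleD(3)[OF P]
    and Q = Rota_Baxter_paired_comoduleD(5)[OF P]
  interpret W: module K W by (rule W)
  interpret P: Rota_Baxter_paired_comodule K C \<Delta> C \<Delta> "\<ominus>\<^bsub>K\<^esub> \<one>\<^bsub>K\<^esub>" Q Q by (rule P)
  let ?\<Delta> = "pre_Lie_comult K C \<Delta> Q"
  note \<Delta>' = pre_Lie_comult_hom[OF C \<Delta> Q]
  have X: "\<Delta> x \<in> carrier (tensor K C C)" if "x \<in> carrier C" for x
    by (rule module_hom_in[OF \<Delta> that])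
  have Qx: "Q x \<in> carrier C" if "x \<in> carrier C" for x by (rule module_hom_in[OF Q that])
  note lift' = tensor_lift_pre_Lie_comult[OF C W \<Delta> Q]
  note Hy = trilinear_mapD(1)[OF H] and Hx = trilinear_mapD(2)[OF H]
  note iter_bil = bilinear_iter_coaction[OF C C \<Delta> \<Delta> W]
    and comult_bil = bilinear_comult_coaction[OF C C \<Delta> \<Delta> W]
    and iter_minus = iter_coaction_minus[OF C C \<Delta> \<Delta> W]
    and coassoc = comult_eq_iter_coaction[OF P.left_comodule_axioms W _ c]

  \<comment> \<open>Write \<Delta> c as x \<otimes> y. \<open>U\<close> and \<open>V\<close> come
    from (\<Delta>' \<otimes> id) \<Delta>' and already include the Rota-Baxter step;
    \<open>S\<close> and \<open>R\<close> come from (id \<otimes> \<Delta>') \<Delta>'.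
    \<open>U\<close> and \<open>R\<close> split x further, so they are evaluated along (\<Delta>
    \<otimes> id) \<Delta>; \<open>V\<close> and \<open>S\<close> split y and are evaluated along
    (id \<otimes> \<Delta>) \<Delta>.\<close>
  define U where "U a b y = H (Q a) (Q b) y \<ominus>\<^bsub>W\<^esub> derived_form W Q Q (\<lambda>a b. H a b y) a b" for a b y
  define V where "V x a b = H (Q a) (Q b) x" for x a b
  define R where "R a b y = comult_form W Q (H (Q y)) a b" for a b y
  define S where "S x a b = comult_form W Q (H (Q x)) a b \<ominus>\<^bsub>W\<^esub> comult_form W Q (H x) a b" for x a b
  have HQQ: "trilinear_map K C C C W (\<lambda>a b y. H (Q a) (Q b) y)"
    by (rule trilinear_map_pre1[OF trilinear_map_pre2[OF H Q] Q])
  have D: "trilinear_map K C C C W (\<lambda>a b y. derived_form W Q Q (\<lambda>a b. H a b y) a b)"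
    unfolding derived_form_def
    by (rule trilinear_map_minus[OF W trilinear_map_plus[OF W trilinear_map_pre1[OF H Q]
            trilinear_map_pre2[OF H Q]] H])
  have U: "trilinear_map K C C C W U"
    unfolding U_def by (rule trilinear_map_minus[OF W HQQ D])
  have V: "trilinear_map K C C C W V"
    unfolding V_def by (rule trilinear_map_swap12[OF trilinear_map_swap23[OF HQQ]])
  note N = comult_form_trilinear[OF W Q H]
  note NQ = trilinear_map_pre1[OF N Q]
  have R: "trilinear_map K C C C W R"
    unfolding R_def by (rule trilinear_map_swap23[OF trilinear_map_swap12[OF NQ]])
  have S: "trilinear_map K C C C W S"
    unfolding S_def by (rule trilinear_map_minus[OF W NQ N])

  have "comult_coaction K C ?\<Delta> C ?\<Delta> W H c = iter_coaction K C C \<Delta> W (\<lambda>x a b. U x a b \<ominus>\<^bsub>W\<^esub> V x a b) c"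
  proof -
    let ?J = "\<lambda>x y. tensor_lift K C C W (\<lambda>a b. H a b y) (?\<Delta> x)"
    have J: "bilinear_map K C C W ?J" by (rule bilinear_comult_coaction[OF C C \<Delta>' \<Delta> W H])
    have J_eq: "?J x y = tensor_lift K C C W (derived_form W Q Q (\<lambda>a b. H a b y)) (\<Delta> x)"
      if "x \<in> carrier C" "y \<in> carrier C" for x y
      by (rule tensor_lift_pre_Lie_comult_alternating[OF C W \<Delta> Q Hy[OF that(2)] that(1) anti[OF _ _ that(2)]])
    \<comment> \<open>The Rota-Baxter condition enters on this side only: in (id \<otimes>
      \<Delta>') \<Delta>' the operator Q of the outer form never acts on the factor that is split
      next.\<close>
    have J_Q: "?J (Q x) y = tensor_lift K C C W (\<lambda>a b. H (Q a) (Q b) y) (\<Delta> x)"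
      if "x \<in> carrier C" "y \<in> carrier C" for x y
      unfolding J_eq[OF Qx[OF that(1)] that(2)] by (rule derived_form_paired[OF P W Hy[OF that(2)] that(1)])
    have "comult_coaction K C ?\<Delta> C ?\<Delta> W H c = tensor_lift K C C W (comult_form W Q ?J) (\<Delta> c)"
      unfolding comult_coaction_def by (rule lift'[OF J c])
    also have "\<dots> = tensor_lift K C C W (\<lambda>x y. tensor_lift K C C W (\<lambda>a b. U a b y) (\<Delta> x) \<ominus>\<^bsub>W\<^esub>
        tensor_lift K C C W (V x) (\<Delta> y)) (\<Delta> c)"
    proof (rule tensor_lift_cong[OF C C W bilinear_map_minus[OF W comult_bil[OF U] iter_bil[OF V]] _ X[OF c]])
      fix x y assume x: "x \<in> carrier C" and y: "y \<in> carrier C"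
      have V_eq: "tensor_lift K C C W (V x) (\<Delta> y) = ?J (Q y) x"
        unfolding J_Q[OF y x] V_def[abs_def] ..
      have U_eq: "tensor_lift K C C W (\<lambda>a b. U a b y) (\<Delta> x) = ?J (Q x) y \<ominus>\<^bsub>W\<^esub> ?J x y"
        unfolding J_Q[OF x y] J_eq[OF x y] U_def[abs_def]
        by (rule tensor_lift_minus[OF C C W trilinear_mapD(1)[OF HQQ y] trilinear_mapD(1)[OF D y] X[OF x]])
      show "comult_form W Q ?J x y = tensor_lift K C C W (\<lambda>a b. U a b y) (\<Delta> x) \<ominus>\<^bsub>W\<^esub>
          tensor_lift K C C W (V x) (\<Delta> y)"
        unfolding V_eq U_eq comult_form_def
        using bilinear_map_in[OF J Qx[OF x] y] bilinear_map_in[OF J Qx[OF y] x] bilinear_map_in[OF J x y]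
        by (simp add: a_minus_def W.M.a_ac)
    qed
    also have "\<dots> = comult_coaction K C \<Delta> C \<Delta> W U c \<ominus>\<^bsub>W\<^esub> iter_coaction K C C \<Delta> W V c"
      unfolding comult_coaction_def iter_coaction_def
      by (rule tensor_lift_minus[OF C C W comult_bil[OF U] iter_bil[OF V] X[OF c]])
    also have "\<dots> = iter_coaction K C C \<Delta> W (\<lambda>x a b. U x a b \<ominus>\<^bsub>W\<^esub> V x a b) c"
      unfolding iter_minus[OF U V c] coassoc[OF U] ..
    finally show ?thesis .
  qed
  also have "\<dots> = iter_coaction K C C \<Delta> W (\<lambda>x a b. S x a b \<ominus>\<^bsub>W\<^esub> R x a b) c"
  proof (rule iter_coaction_cong[OF C C \<Delta> \<Delta> W trilinear_map_minus[OF W S R] _ c])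
    fix x a b assume *: "x \<in> carrier C" "a \<in> carrier C" "b \<in> carrier C"
    \<comment> \<open>Exchanging the first two arguments in each of the three terms brings them to
      the values of \<open>H\<close> that occur in \<open>S\<close> and \<open>V\<close>.\<close>
    have R_eq: "R x a b = \<ominus>\<^bsub>W\<^esub> H (Q x) (Q b) a \<ominus>\<^bsub>W\<^esub> \<ominus>\<^bsub>W\<^esub> H (Q a) (Q b) x \<ominus>\<^bsub>W\<^esub> \<ominus>\<^bsub>W\<^esub> H x (Q b) a"
      unfolding R_def comult_form_def
      using anti[of "Q x" "Q b" a] anti[of "Q a" "Q b" x] anti[of x "Q b" a] * Qx by simp
    show "U x a b \<ominus>\<^bsub>W\<^esub> V x a b = S x a b \<ominus>\<^bsub>W\<^esub> R x a b"
      unfolding R_eq S_def U_def V_def comult_form_def derived_form_def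
      using * Qx trilinear_map_in[OF H] by (intro W.M.pre_Lie_comult_cancel[symmetric]) auto
  qed
  also have "\<dots> = iter_coaction K C C ?\<Delta> W H c"
  proof -
    let ?L = "\<lambda>x y. tensor_lift K C C W (H x) (?\<Delta> y)"
    have L: "bilinear_map K C C W ?L" by (rule bilinear_iter_coaction[OF C C \<Delta> \<Delta>' W H])
    have L_eq: "?L x y = tensor_lift K C C W (comult_form W Q (H x)) (\<Delta> y)"
      if "x \<in> carrier C" "y \<in> carrier C" for x y
      by (rule lift'[OF Hx[OF that(1)] that(2)])
    have "iter_coaction K C C ?\<Delta> W H c = tensor_lift K C C W (comult_form W Q ?L) (\<Delta> c)"
      unfolding iter_coaction_def by (rule lift'[OF L c])
    also have "\<dots> = tensor_lift K C C W (\<lambda>x y. tensor_lift K C C W (S x) (\<Delta> y) \<ominus>\<^bsub>W\<^esub>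
        tensor_lift K C C W (\<lambda>a b. R a b y) (\<Delta> x)) (\<Delta> c)"
    proof (rule tensor_lift_cong[OF C C W bilinear_map_minus[OF W iter_bil[OF S] comult_bil[OF R]] _ X[OF c]])
      fix x y assume x: "x \<in> carrier C" and y: "y \<in> carrier C"
      have R_eq: "tensor_lift K C C W (\<lambda>a b. R a b y) (\<Delta> x) = ?L (Q y) x"
        unfolding L_eq[OF Qx[OF y] x] R_def[abs_def] ..
      have S_eq: "tensor_lift K C C W (S x) (\<Delta> y) = ?L (Q x) y \<ominus>\<^bsub>W\<^esub> ?L x y"
        unfolding L_eq[OF Qx[OF x] y] L_eq[OF x y] S_def[abs_def]
        by (rule tensor_lift_minus[OF C C W trilinear_mapD(2)[OF NQ x] trilinear_mapD(2)[OF N x] X[OF y]])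
      show "comult_form W Q ?L x y = tensor_lift K C C W (S x) (\<Delta> y) \<ominus>\<^bsub>W\<^esub>
          tensor_lift K C C W (\<lambda>a b. R a b y) (\<Delta> x)"
        unfolding R_eq S_eq comult_form_def
        using bilinear_map_in[OF L Qx[OF x] y] bilinear_map_in[OF L Qx[OF y] x] bilinear_map_in[OF L x y]
        by (simp add: a_minus_def W.M.a_ac)
    qed
    also have "\<dots> = iter_coaction K C C \<Delta> W S c \<ominus>\<^bsub>W\<^esub> comult_coaction K C \<Delta> C \<Delta> W R c"
      unfolding comult_coaction_def iter_coaction_def
      by (rule tensor_lift_minus[OF C C W iter_bil[OF S] comult_bil[OF R] X[OF c]])
    also have "\<dots> = iter_coaction K C C \<Delta> W (\<lambda>x a b. S x a b \<ominus>\<^bsub>W\<^esub> R x a b) c"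
      unfolding iter_minus[OF S R c] coassoc[OF R] ..
    finally show ?thesis ..
  qed
  finally show ?thesis ..
qed

text \<open>C is regarded as a comodule over itself by \<Delta>'. The coassociators of coalgebras
  and of comodules are defined with opposite signs, and the condition survives a change of sign
  because the swap is linear.\<close>

theorem pre_Lie_coalgebra_pre_Lie_comult:
  assumes CQ: "Rota_Baxter_coalgebra K C \<Delta> (\<ominus>\<^bsub>K\<^esub> \<one>\<^bsub>K\<^esub>) Q"
  shows "pre_Lie_coalgebra K C (pre_Lie_comult K C \<Delta> Q)"
proof -
  interpret Rota_Baxter_coalgebra K C \<Delta> "\<ominus>\<^bsub>K\<^esub> \<one>\<^bsub>K\<^esub>" Q by (rule CQ)
  note P = Rota_Baxter_coalgebra_paired[OF CQ]
  note C = Rota_Baxter_paired_comoduleD(1)[OF P] and \<Delta> = Rota_Baxter_paired_comoduleD(3)[OF P]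
    and Q = Rota_Baxter_paired_comoduleD(5)[OF P]
  let ?\<Delta> = "pre_Lie_comult K C \<Delta> Q" and ?V = "tensor K (tensor K C C) C"
  let ?S = "tensor_map K (tensor K C C) C (tensor K C C) C (tensor_swap K C C) id"
  note \<Delta>' = pre_Lie_comult_hom[OF C \<Delta> Q]
  note CC = tensor_module[OF C C]
  note V = tensor_module[OF CC C]
  interpret V: module K ?V by (rule V)
  have S: "?S \<in> module_hom K ?V ?V"
    by (rule tensor_map_hom[OF CC C CC C tensor_swap_hom[OF C C \<Delta> \<Delta>] module_hom_id])
  show ?thesis
  proof unfold_locales
    show "?\<Delta> \<in> module_hom K C (tensor K C C)" by (rule \<Delta>')
  next
    fix c assume c: "c \<in> carrier C"
    let ?Z = "comodule_coassociator K C ?\<Delta> C ?\<Delta> c"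
    note closed = comodule_coassociator_closed[OF C C \<Delta>' \<Delta>' c]
    have Z: "coassociator K C ?\<Delta> c = \<ominus>\<^bsub>?V\<^esub> ?Z"
      unfolding coassociator_def comodule_coassociator_def
      using closed(1,2) by (simp add: a_minus_def V.M.minus_add V.M.a_comm)
    have "?Z \<ominus>\<^bsub>?V\<^esub> ?S ?Z = \<zero>\<^bsub>?V\<^esub>"
      by (rule pre_Lie_comodule_conditionI[OF C C \<Delta>' \<Delta>' iter_eq_comult_pre_Lie_comult[OF CQ V _ c] c])
    then have "?S ?Z = ?Z"
      using closed(3) module_hom_in[OF S closed(3)] by simp
    then show "coassociator K C ?\<Delta> c \<ominus>\<^bsub>?V\<^esub> ?S (coassociator K C ?\<Delta> c) = \<zero>\<^bsub>?V\<^esub>"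
      unfolding Z module_hom_uminus[OF V V S closed(3)]
      using closed(3) by (simp add: a_minus_def V.M.l_neg)
  qed
qed

theorem proposition5p4:
  fixes K :: "('k, 'r) ring_scheme"
    and C :: "('k, 'c, 'x) module_scheme"
    and M :: "('k, 'm, 'y) module_scheme"
    and \<Delta> :: "'c \<Rightarrow> ('c \<times> 'c \<Rightarrow> 'k) set"
    and \<rho> :: "'m \<Rightarrow> ('c \<times> 'm \<Rightarrow> 'k) set"
    and Q :: "'c \<Rightarrow> 'c" and T :: "'m \<Rightarrow> 'm"
  assumes "field K"
    and "Rota_Baxter_coalgebra K C \<Delta> (\<ominus>\<^bsub>K\<^esub> \<one>\<^bsub>K\<^esub>) Q"
    and "Rota_Baxter_paired_comodule K C \<Delta> M \<rho> (\<ominus>\<^bsub>K\<^esub> \<one>\<^bsub>K\<^esub>) Q T"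
  shows "left_pre_Lie_comodule K C (pre_Lie_comult K C \<Delta> Q) M (pre_Lie_coaction K C M \<rho> Q T)"
proof -
  note CQ = assms(2) and P = assms(3)
  interpret P: Rota_Baxter_paired_comodule K C \<Delta> M \<rho> "\<ominus>\<^bsub>K\<^esub> \<one>\<^bsub>K\<^esub>" Q T by (rule P)
  interpret L: pre_Lie_coalgebra K C "pre_Lie_comult K C \<Delta> Q"
    by (rule pre_Lie_coalgebra_pre_Lie_comult[OF CQ])
  note C = Rota_Baxter_paired_comoduleD(1)[OF P] and M = Rota_Baxter_paired_comoduleD(2)[OF P]
    and \<Delta> = Rota_Baxter_paired_comoduleD(3)[OF P]
    and \<rho> = Rota_Baxter_paired_comoduleD(4)[OF P] and Q = Rota_Baxter_paired_comoduleD(5)[OF P]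
    and T = Rota_Baxter_paired_comoduleD(6)[OF P]
  note \<Delta>' = pre_Lie_comult_hom[OF C \<Delta> Q] and \<rho>' = pre_Lie_coaction_hom[OF C M \<rho> Q T]
  show ?thesis
  proof unfold_locales
    show "pre_Lie_coaction K C M \<rho> Q T \<in> module_hom K M (tensor K C M)" by (rule \<rho>')
  next
    fix m assume m: "m \<in> carrier M"
    let ?V = "tensor K (tensor K C C) M"
    have V: "module K ?V" by (rule tensor_module[OF tensor_module[OF C C] M])
    show "comodule_coassociator K C (pre_Lie_comult K C \<Delta> Q) M (pre_Lie_coaction K C M \<rho> Q T) m
        \<ominus>\<^bsub>?V\<^esub> tensor_map K (tensor K C C) M (tensor K C C) M (tensor_swap K C C) id
          (comodule_coassociator K C (pre_Lie_comult K C \<Delta> Q) M (pre_Lie_coaction K C M \<rho> Q T) m)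
        = \<zero>\<^bsub>?V\<^esub>"
    proof (rule pre_Lie_comodule_conditionI[OF C M \<Delta>' \<rho>' _ m])
      fix H assume H: "trilinear_map K C C M ?V H"
        and anti: "\<And>a b n. a \<in> carrier C \<Longrightarrow> b \<in> carrier C \<Longrightarrow> n \<in> carrier M \<Longrightarrow>
          H b a n = \<ominus>\<^bsub>?V\<^esub> H a b n"
      \<comment> \<open>Coassociativity is known for \<rho> and not for \<rho>', so it is applied to
        \<open>derived_trilinear\<close> of \<open>H\<close>, after both sides have been pulled back
        to \<rho>.\<close>
      show "iter_coaction K C M (pre_Lie_coaction K C M \<rho> Q T) ?V H m =
          comult_coaction K C (pre_Lie_comult K C \<Delta> Q) M (pre_Lie_coaction K C M \<rho> Q T) ?V H m"
        using iter_pre_Lie_coaction[OF P V H m] comult_pre_Lie_coaction[OF CQ P V H m anti]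
          comult_eq_iter_coaction[OF P.left_comodule_axioms V derived_trilinear_trilinear[OF V Q T H] m]
        by simp
    qed
  qed
qed

end
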